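(* For every $\gamma>1$ there is a constant $\Gamma(\gamma)>0$, depending only on $\gamma$, such that the following holds. Let $0<T<\infty$ and let $(\rho,u)$ be a weak solution on $S_T$ of the compressible Euler equations with pressure $p(\rho)=\gamma^{-1}\rho^\gamma$ and initial data $(\rho_0,u_0)$ (in the sense defined in the context). Fix a unit vector $\omega\in\mathbb{R}^3$ and a parameter $0\le k_0<1$. Define $$w_0(k)=\tfrac12\int_{\Omega^{k,1}(0)}\bigl(\omega\cdot\rho_0u_0(x)+\rho_0(x)-1\bigr)(\omega\cdot x-k)^2\,dx,\qquad k_0\le k\le 1 .$$ (Since $(\rho_0,u_0)\in L^\infty$, $w_0$ is continuous on $k_0\le k\le1$.) Suppose that $$\operatorname{ess\,supp}(\rho-1,u)\cap\Omega_T^{k_0,\infty}\subset\Omega_T^{k_0,1},$$ and that $w_0$ is positive and decreasing for $k_0\le k<1$. Then the lifespan $T$ satisfies $T\le T_0(k_0)$, where $$T_0(k_0)=\inf_{k_0<k<1}T(k,k_0)-\frac{1+k_0}{2}$$ and $$T(k,k_0)=\begin{cases}\displaystyle\exp\left[\Gamma(\gamma)\frac{(1-k_0)^6}{(k-k_0)\,w_0(k)}\right],&\gamma\ge2,\\[4mm]\displaystyle\exp\left[\Gamma(\gamma)\frac{(1-k_0)^6}{(k-k_0)\,w_0(k)}\left(1+\frac{3w_0(k)}{(1-k)^4}\right)^{2-\gamma}\right],&1<\gamma<2.\end{cases}$$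
   Context: For $0<T<\infty$ set $S_T=[0,T)\times\mathbb{R}^3$. The compressible Euler equations are $\partial_t\rho+\nabla\cdot(\rho u)=0$, $\partial_t(\rho u)+\nabla\cdot(\rho u\otimes u)+\nabla p(\rho)=0$, with $p(\rho)=\gamma^{-1}\rho^\gamma$, $\gamma>1$. The background density is $1$ and the corresponding sound speed is $p'(1)^{1/2}=1$. Weak solution: $(\rho,u)$ is a weak solution on $S_T$ with initial data $(\rho_0,u_0)$ if $(\rho,u)\in L^\infty(S_T;\mathbb{R}_{>0}\times\mathbb{R}^3)$, $(\rho_0,u_0)\in L^\infty(\mathbb{R}^3;\mathbb{R}_{>0}\times\mathbb{R}^3)$ (positivity of $\rho,\rho_0$ is understood almost everywhere), and $$\iint_{S_T}(\rho\,\partial_t\varphi+\rho u\cdot\nabla_x\varphi)\,dx\,dt+\int_{\mathbb{R}^3}\rho_0\,\varphi(0,\cdot)\,dx=0,$$ $$\iint_{S_T}\bigl(\rho u\cdot\partial_t\psi+\rho\langle u\otimes u,\nabla_x\psi\rangle+\tfrac1\gamma\rho^\gamma\,\nabla_x\cdot\psi\bigr)dx\,dt+\int_{\mathbb{R}^3}\rho_0u_0\cdot\psi(0,\cdot)\,dx=0$$ for all $(\varphi,\psi)\in C^{0,1}_0(S_T;\mathbb{R}\times\mathbb{R}^3)$, i.e. all Lipschitz pairs with compact support in $S_T=[0,T)\times\mathbb{R}^3$ (so they need not vanish at $t=0$). Domains: for a fixed unit vector $\omega\in\mathbb{R}^3$, $0\le a\le b<\infty$ and $t\ge0$, $$\Omega^{a,\infty}(t)=\{x\in\mathbb{R}^3:a+t\le\omega\cdot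 x\},\qquad \Omega^{a,b}(t)=\Omega^{a,\infty}(t)\cap\{x\in\mathbb{R}^3:|x|\le b+t\},$$ and for $b\le\infty$, $\Omega_T^{a,b}=\{(t,x)\in S_T:x\in\Omega^{a,b}(t)\}$. $\operatorname{ess\,supp}$ denotes the essential support: the complement (in the domain) of the largest relatively open set on which the function vanishes a.e. *)

theory Defs
  imports "HOL-Analysis.Analysis"
begin

type_synonym space = "real ^ 3"
type_synonym spacetime = "real \<times> space"

definition slab :: "real \<Rightarrow> spacetime set" where
  "slab T = {0..<T} \<times> UNIV"

definition pressure :: "real \<Rightarrow> real \<Rightarrow> real" where
  "pressure \<gamma> r = r powr \<gamma> / \<gamma>"

definition Linf_on :: "'a::euclidean_space set \<Rightarrow> ('a \<Rightarrow> 'b::euclidean_space) \<Rightarrow> bool" where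
  "Linf_on S f \<longleftrightarrow>
     f \<in> borel_measurable (lebesgue_on S) \<and>
     (\<exists>C. AE z in lebesgue_on S. norm (f z) \<le> C)"

text \<open>Only the values on \<^term>\<open>slab T\<close> matter. The support may meet the initial
  time \<open>t = 0\<close>, but it stays away from \<open>t = T\<close>.\<close>

definition test_function :: "real \<Rightarrow> (spacetime \<Rightarrow> 'b::real_normed_vector) \<Rightarrow> bool" where
  "test_function T f \<longleftrightarrow>
     (\<exists>L. lipschitz_on L (slab T) f) \<and>
     (\<exists>K. compact K \<and> K \<subseteq> slab T \<and> (\<forall>z\<in>slab T - K. f z = 0))"

text \<open>The derivatives below are classical ones. A Lipschitz function on the slab is
  differentiable almost everywhere (Rademacher), and the junk value of
  \<^const>\<open>frechet_derivative\<close> on the remaining null set does not affect integrals over the slab.\<close>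

definition dt :: "(spacetime \<Rightarrow> 'b::real_normed_vector) \<Rightarrow> spacetime \<Rightarrow> 'b" where
  "dt f z = frechet_derivative f (at z) (1, 0)"

definition dx :: "3 \<Rightarrow> (spacetime \<Rightarrow> 'b::real_normed_vector) \<Rightarrow> spacetime \<Rightarrow> 'b" where
  "dx i f z = frechet_derivative f (at z) (0, axis i 1)"

definition grad :: "(spacetime \<Rightarrow> real) \<Rightarrow> spacetime \<Rightarrow> space" where
  "grad \<phi> z = (\<chi> i. dx i \<phi> z)"

definition divergence :: "(spacetime \<Rightarrow> space) \<Rightarrow> spacetime \<Rightarrow> real" where
  "divergence \<psi> z = (\<Sum>i\<in>UNIV. dx i \<psi> z $ i)"

text \<open>The pairing of \<open>v \<otimes> v\<close> with the spatial gradient of \<open>\<psi>\<close>.\<close>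

definition tensor_grad :: "space \<Rightarrow> (spacetime \<Rightarrow> space) \<Rightarrow> spacetime \<Rightarrow> real" where
  "tensor_grad v \<psi> z = (\<Sum>i\<in>UNIV. \<Sum>j\<in>UNIV. v $ i * v $ j * (dx i \<psi> z $ j))"

definition weak_solution ::
  "real \<Rightarrow> real \<Rightarrow> (spacetime \<Rightarrow> real) \<Rightarrow> (spacetime \<Rightarrow> space)
    \<Rightarrow> (space \<Rightarrow> real) \<Rightarrow> (space \<Rightarrow> space) \<Rightarrow> bool" where
  "weak_solution \<gamma> T \<rho> u \<rho>\<^sub>0 u\<^sub>0 \<longleftrightarrow>
     Linf_on (slab T) \<rho> \<and> Linf_on (slab T) u \<and> (AE z in lebesgue_on (slab T). 0 < \<rho> z) \<and>
     Linf_on UNIV \<rho>\<^sub>0 \<and> Linf_on UNIV u\<^sub>0 \<and> (AE x in lebesgue. 0 < \<rho>\<^sub>0 x) \<and>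
     (\<forall>\<phi>::spacetime \<Rightarrow> real. test_function T \<phi> \<longrightarrow>
        (LINT z:slab T|lebesgue. \<rho> z * dt \<phi> z + (\<rho> z *\<^sub>R u z) \<bullet> grad \<phi> z)
        + (LINT x|lebesgue. \<rho>\<^sub>0 x * \<phi> (0, x)) = 0) \<and>
     (\<forall>\<psi>::spacetime \<Rightarrow> space. test_function T \<psi> \<longrightarrow>
        (LINT z:slab T|lebesgue. (\<rho> z *\<^sub>R u z) \<bullet> dt \<psi> z
            + \<rho> z * tensor_grad (u z) \<psi> z + pressure \<gamma> (\<rho> z) * divergence \<psi> z)
        + (LINT x|lebesgue. (\<rho>\<^sub>0 x *\<^sub>R u\<^sub>0 x) \<bullet> \<psi> (0, x)) = 0)"

definition ess_supp :: "'a::euclidean_space set \<Rightarrow> ('a \<Rightarrow> 'b::zero) \<Rightarrow> 'a set" where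
  "ess_supp S f =
     S - \<Union>{U. openin (top_of_set S) U \<and> (AE z in lebesgue. z \<in> U \<longrightarrow> f z = 0)}"

definition Omega_inf :: "space \<Rightarrow> real \<Rightarrow> real \<Rightarrow> space set" where
  "Omega_inf \<omega> a t = {x. a + t \<le> \<omega> \<bullet> x}"

definition Omega :: "space \<Rightarrow> real \<Rightarrow> real \<Rightarrow> real \<Rightarrow> space set" where
  "Omega \<omega> a b t = Omega_inf \<omega> a t \<inter> {x. norm x \<le> b + t}"

definition spacetime_region :: "real \<Rightarrow> (real \<Rightarrow> space set) \<Rightarrow> spacetime set" where
  "spacetime_region T A = {(t, x) \<in> slab T. x \<in> A t}"

definition w0 ::
  "space \<Rightarrow> (space \<Rightarrow> real) \<Rightarrow> (space \<Rightarrow> space) \<Rightarrow> real \<Rightarrow> real" where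
  "w0 \<omega> \<rho>\<^sub>0 u\<^sub>0 k =
     1/2 * (LINT x:Omega \<omega> k 1 0|lebesgue.
              (\<omega> \<bullet> (\<rho>\<^sub>0 x *\<^sub>R u\<^sub>0 x) + \<rho>\<^sub>0 x - 1) * (\<omega> \<bullet> x - k)\<^sup>2)"

text \<open>Here \<open>w\<close> is the function \<open>k \<mapsto> w\<^sub>0(k)\<close> and \<open>\<Gamma>\<close> the constant \<open>\<Gamma>(\<gamma>)\<close>.\<close>

definition lifespan_fun ::
  "real \<Rightarrow> real \<Rightarrow> (real \<Rightarrow> real) \<Rightarrow> real \<Rightarrow> real \<Rightarrow> real" where
  "lifespan_fun \<gamma> \<Gamma> w k k\<^sub>0 =
     (if \<gamma> \<ge> 2
      then exp (\<Gamma> * ((1 - k\<^sub>0) ^ 6 / ((k - k\<^sub>0) * w k)))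
      else exp (\<Gamma> * ((1 - k\<^sub>0) ^ 6 / ((k - k\<^sub>0) * w k))
                 * (1 + 3 * w k / (1 - k) ^ 4) powr (2 - \<gamma>)))"

definition lifespan_bound ::
  "real \<Rightarrow> real \<Rightarrow> (real \<Rightarrow> real) \<Rightarrow> real \<Rightarrow> real" where
  "lifespan_bound \<gamma> \<Gamma> w k\<^sub>0 =
     (INF k\<in>{k\<^sub>0<..<1}. lifespan_fun \<gamma> \<Gamma> w k k\<^sub>0) - (1 + k\<^sub>0) / 2"

end

theory Submission
  imports Defs
begin

text \<open>
  Fix \<open>k\<close> and put \<open>s = \<omega> \<bullet> x - t - k\<close>, \<open>v = \<omega> \<bullet> u\<close>, \<open>N = \<rho> v + \<rho> - 1\<close> and \<open>\<delta> = 1 - k\<close>. Test the mass equation with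
  \<open>\<phi> = \<theta>(t) s\<^sup>2 / 2\<close> on \<open>s > 0\<close> and the momentum equation with \<open>\<phi> \<omega>\<close>, add, and subtract the result for the
  constant state. Since \<open>s\<close> travels with the background sound speed, all linear flux terms cancel, and there
  remains

    \<open>\<theta>(0) w0(k) + \<integral>\<integral> \<theta>' N s\<^sup>2 / 2 + \<theta> s (\<rho> v\<^sup>2 + P(\<rho>)) = 0\<close>,

  where \<open>P \<ge> 0\<close> is the pressure minus its tangent at \<open>\<rho> = 1\<close> (\<open>excess\<close>, \<open>momentum_flux_balance\<close>). The support
  hypothesis confines the double integral to \<open>s > 0\<close>, \<open>norm x \<le> 1 + t\<close>, where \<open>s \<le> \<delta>\<close> and whose
  time sections have volume at most \<open>8 \<delta>\<^sup>2 (1 + t)\<close> (\<open>emeasure_Omega_le\<close>).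

  The source \<open>\<rho> v\<^sup>2 + P(\<rho>)\<close> grows superlinearly in \<open>N\<close>: up to constants it is at least
  \<open>l N - l\<^sup>2 - l\<^sup>n\<close> for every slope \<open>l \<ge> 0\<close>, with an integer \<open>n\<close> that depends on \<open>\<gamma>\<close>
  (\<open>flux_dominates_momentum\<close>). A capacity argument replaces the differential inequality
  that this suggests for the moment: for a decreasing weight \<open>\<theta>\<close>, the slope \<open>l\<close> proportional to \<open>- \<delta> \<theta>' / \<theta>\<close> lets the two terms in \<open>N\<close> cancel,
  and the moment is bounded by an integral over the region of \<open>\<theta> (l\<^sup>2 + l\<^sup>n)\<close>, which no longer
  involves the solution (\<open>clock_lower_bound\<close>). With \<open>\<theta> = (1 - ln (1 + t) / L)\<^sup>n\<close>, vanishing at the time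
  \<open>T' < T\<close> for which \<open>L = ln (1 + T')\<close>, this gives

    \<open>w0(k) \<le> const \<delta>\<^sup>3 L ((\<kappa> \<delta> / L)\<^sup>2 + (\<kappa> \<delta> / L)\<^sup>n)\<close>

  (\<open>moment_bound\<close>). Hence either \<open>L < \<delta> / 4\<close>, and then \<open>T' \<le> \<delta> / 2\<close>, or \<open>L \<le> \<Gamma> \<delta>\<^sup>5 / w0(k)\<close>. Both
  alternatives give \<open>T' \<le> exp (\<Gamma> \<delta>\<^sup>5 / w0(k)) - (1 + k\<^sub>0) / 2\<close>, and this is at most the asserted bound because
  \<open>(k - k\<^sub>0) \<delta>\<^sup>5 \<le> (1 - k\<^sub>0)\<^sup>6\<close>.
\<close>

section \<open>The source dominates the momentum\<close>

text \<open>The part of the pressure that survives when its tangent at the background density is removed.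
  It is the only contribution of the pressure to the growth of the moment, because the linear part
  travels with the sound speed \<open>1\<close> of the background.\<close>

definition excess :: "real \<Rightarrow> real \<Rightarrow> real" where
  "excess \<gamma> r = pressure \<gamma> r - 1 / \<gamma> - (r - 1)"

lemma excess_nonneg:
  assumes "1 < \<gamma>" "0 < r"
  shows "0 \<le> excess \<gamma> r"
proof -
  have "(r powr \<gamma>) powr (1 / \<gamma>) * 1 powr (1 - 1 / \<gamma>) \<le> (1 / \<gamma>) * r powr \<gamma> + (1 - 1 / \<gamma>) * 1"
    using assms by (intro Youngs_inequality_0) auto
  then show ?thesis
    using assms by (simp add: excess_def pressure_def powr_powr algebra_simps)
qed

text \<open>Strict convexity at the background density. The derivative
  \<open>(1 + x) powr (\<gamma> - 1) - 1\<close> of the excess is at least \<open>(\<gamma> - 1) ln (1 + x)\<close>, and the logarithm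
  dominates \<open>x / (1 + R)\<close> on \<open>[0, R]\<close>; so one argument covers both \<open>\<gamma> < 2\<close> and \<open>\<gamma> \<ge> 2\<close>.\<close>

lemma excess_small:
  assumes \<gamma>: "1 < \<gamma>" and R: "0 \<le> R" and r: "0 \<le> r" "r \<le> R"
  shows "(\<gamma> - 1) / (2 * (1 + R)) * r\<^sup>2 \<le> excess \<gamma> (1 + r)"
proof -
  define a where "a = (\<gamma> - 1) / (2 * (1 + R))"
  have a: "2 * a * x = (\<gamma> - 1) * (x / (1 + R))" for x
    using R by (simp add: a_def field_simps)
  define D where "D x = excess \<gamma> (1 + x) - a * x\<^sup>2" for x
  have "D 0 \<le> D r"
  proof (rule DERIV_nonneg_imp_nondecreasing[OF r(1)])
    fix x assume x: "0 \<le> x" "x \<le> r"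
    have d: "(D has_real_derivative ((1 + x) powr (\<gamma> - 1) - 1 - 2 * a * x)) (at x)"
      unfolding D_def excess_def pressure_def
      using x \<gamma> by (auto intro!: derivative_eq_intros)
    have "x / (1 + R) \<le> x / (1 + x)"
      using x r R by (intro divide_left_mono) auto
    also have "\<dots> \<le> ln (1 + x)"
      using ln_add_one_self_le_self2[of "- (x / (1 + x))"] x ln_le_minus_one[of "1 / (1 + x)"]
      by (simp add: ln_div field_simps)
    finally have "(\<gamma> - 1) * (x / (1 + R)) \<le> (\<gamma> - 1) * ln (1 + x)"
      using \<gamma> by (intro mult_left_mono) auto
    also have "\<dots> \<le> exp ((\<gamma> - 1) * ln (1 + x)) - 1"
      using exp_ge_add_one_self[of "(\<gamma> - 1) * ln (1 + x)"] by linarith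
    also have "\<dots> = (1 + x) powr (\<gamma> - 1) - 1"
      using x by (simp add: powr_def)
    finally have "0 \<le> (1 + x) powr (\<gamma> - 1) - 1 - 2 * a * x" by (simp add: a)
    with d show "\<exists>y. DERIV D x :> y \<and> 0 \<le> y" by blast
  qed
  moreover have "D 0 = 0" by (simp add: D_def excess_def pressure_def)
  ultimately show ?thesis by (simp add: D_def a_def)
qed

text \<open>The threshold on \<open>r\<close> is the one beyond which half of \<open>(1 + r) powr \<gamma> / \<gamma>\<close> absorbs the
  linear term of the excess.\<close>

lemma excess_large:
  assumes \<gamma>: "1 < \<gamma>" and r: "(2 * \<gamma>) powr (1 / (\<gamma> - 1)) \<le> r"
  shows "r powr \<gamma> / (2 * \<gamma>) \<le> excess \<gamma> (1 + r)"
proof -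
  have r0: "0 < r" using r \<gamma> by (auto intro: less_le_trans[OF _ r])
  have "2 * \<gamma> = ((2 * \<gamma>) powr (1 / (\<gamma> - 1))) powr (\<gamma> - 1)"
    using \<gamma> by (simp add: powr_powr)
  also have "\<dots> \<le> (1 + r) powr (\<gamma> - 1)"
    using r \<gamma> by (intro powr_mono2) auto
  finally have "(1 + r) * (2 * \<gamma>) \<le> (1 + r) * (1 + r) powr (\<gamma> - 1)"
    using r0 by (intro mult_left_mono) auto
  also have "\<dots> = (1 + r) powr \<gamma>"
    using r0 powr_add[of "1 + r" 1 "\<gamma> - 1"] by simp
  finally have "(1 + r) * (2 * \<gamma>) \<le> (1 + r) powr \<gamma>" .
  moreover have "r powr \<gamma> \<le> (1 + r) powr \<gamma>" using r0 \<gamma> by (intro powr_mono2) auto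
  ultimately have "r powr \<gamma> + (1 + r) * (2 * \<gamma>) \<le> 2 * (1 + r) powr \<gamma>" by linarith
  moreover have "0 \<le> 1 - 1 / \<gamma>" using \<gamma> by simp
  ultimately show ?thesis
    using \<gamma> by (simp add: excess_def pressure_def field_simps)
qed

text \<open>A Young inequality against the excess, which behaves like \<open>r\<^sup>2\<close> for small \<open>r\<close> and like
  \<open>r powr \<gamma>\<close> for large \<open>r\<close>. The quadratic range costs \<open>l\<^sup>2\<close>. In the other range the factor of \<open>r\<close>
  is essentially \<open>l\<^sup>2\<close>, and its conjugate power is \<open>l\<close> to the exponent \<open>2 \<gamma> / (\<gamma> - 1)\<close>; any larger
  integer exponent \<open>n\<close> serves as well, since \<open>l\<^sup>2\<close> takes care of \<open>l \<le> 1\<close>.\<close>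
lemma density_young:
  assumes \<gamma>: "1 < \<gamma>"
  obtains C K and n :: nat where "1 \<le> C" "1 \<le> K" "3 \<le> n"
    and "\<And>l r. 0 \<le> l \<Longrightarrow> 0 \<le> r \<Longrightarrow> (l + l\<^sup>2 / 4) * r \<le> C * excess \<gamma> (1 + r) + K * (l\<^sup>2 + l ^ n)"
proof -
  define R where "R = (2 * \<gamma>) powr (1 / (\<gamma> - 1))"
  have R: "1 \<le> R" unfolding R_def using \<gamma> by (intro ge_one_powr_ge_zero) auto
  define q where "q = \<gamma> / (\<gamma> - 1)"
  have q: "0 < q" "q = 1 + 1 / (\<gamma> - 1)" using \<gamma> by (auto simp: q_def field_simps)
  obtain n0 :: nat where n0: "2 * q \<le> real n0" using real_arch_simple by blast
  define n where "n = max 3 n0"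
  define C where "C = 2 * (1 + R) / (\<gamma> - 1) + 4 * \<gamma>"
  define K where "K = R + 2 powr q"
  have K: "1 \<le> K" "1 + R / 4 \<le> K + 1" "2 powr q \<le> K" "1/4 + R / 4 \<le> K"
    using R powr_ge_zero[of 2 q] unfolding K_def by linarith+
  have "(l + l\<^sup>2 / 4) * r \<le> C * excess \<gamma> (1 + r) + K * (l\<^sup>2 + l ^ n)"
    if l: "0 \<le> l" and r: "0 \<le> r" for l r
  proof (cases "r \<le> R")
    case True
    have e: "0 \<le> excess \<gamma> (1 + r)" using excess_nonneg \<gamma> r by simp
    have "r\<^sup>2 \<le> 2 * (1 + R) / (\<gamma> - 1) * excess \<gamma> (1 + r)"
      using excess_small[OF \<gamma> _ r True] \<gamma> R by (simp add: field_simps)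
    also have "\<dots> \<le> C * excess \<gamma> (1 + r)"
      using e \<gamma> by (intro mult_right_mono) (auto simp: C_def)
    finally have 1: "r\<^sup>2 \<le> C * excess \<gamma> (1 + r)" .
    have 2: "l * r \<le> l\<^sup>2 / 4 + r\<^sup>2"
      using zero_le_power2[of "l / 2 - r"] by (simp add: power2_eq_square field_simps)
    have 3: "l\<^sup>2 / 4 * r \<le> l\<^sup>2 / 4 * R" using True by (intro mult_left_mono) auto
    have "(1/4 + R / 4) * l\<^sup>2 \<le> K * l\<^sup>2" using K by (intro mult_right_mono) auto
    moreover have "0 \<le> K * l ^ n" using K l by simp
    ultimately show ?thesis using 1 2 3 by (simp add: algebra_simps)
  next
    case False
    then have rR: "R \<le> r" and r1: "1 \<le> r" using R by auto
    have rp: "r powr \<gamma> \<le> 2 * \<gamma> * excess \<gamma> (1 + r)"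
      using excess_large[OF \<gamma>, of r] rR \<gamma> by (simp add: R_def field_simps)
    have e: "0 \<le> excess \<gamma> (1 + r)" using excess_nonneg \<gamma> r by simp
    have "0 \<le> 2 * (1 + R) / (\<gamma> - 1)" using R \<gamma> by simp
    then have C2: "2 * r powr \<gamma> \<le> C * excess \<gamma> (1 + r)"
      using rp mult_right_mono[OF _ e, of "4 * \<gamma>" C] by (simp add: C_def)
    have C1: "r powr \<gamma> \<le> C * excess \<gamma> (1 + r)"
      using C2 powr_ge_zero[of r \<gamma>] by linarith
    have rg: "r = r powr 1" "r powr 1 \<le> r powr \<gamma>" using r1 \<gamma> powr_mono[of 1 \<gamma> r] by auto
    show ?thesis
    proof (cases "l \<le> 1")
      case True
      have "l\<^sup>2 \<le> 1" using True l by (simp add: power_le_one)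
      then have "(l + l\<^sup>2 / 4) * r \<le> 2 * r" using True r1 by (intro mult_right_mono) auto
      also have "\<dots> \<le> 2 * r powr \<gamma>" using rg by simp
      finally have "(l + l\<^sup>2 / 4) * r \<le> C * excess \<gamma> (1 + r)" using C2 by linarith
      moreover have "0 \<le> K * (l\<^sup>2 + l ^ n)" using K l by simp
      ultimately show ?thesis by linarith
    next
      case False
      then have l1: "1 \<le> l" by simp
      then have "l \<le> l\<^sup>2" by (simp add: power2_eq_square)
      then have a: "(l + l\<^sup>2 / 4) * r \<le> 2 * l\<^sup>2 * r"
        using r1 zero_le_power2[of l] by (intro mult_right_mono) linarith+
      have pos: "0 \<le> r powr \<gamma>" "0 \<le> K * l\<^sup>2" "0 \<le> K * l ^ n" using K l by auto
      show ?thesis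
      \<comment> \<open>The two terms of the Young inequality balance at \<open>2 l\<^sup>2 = r powr (\<gamma> - 1)\<close>.\<close>
      proof (cases "2 * l\<^sup>2 \<le> r powr (\<gamma> - 1)")
        case True
        have "2 * l\<^sup>2 * r \<le> r powr (\<gamma> - 1) * r powr 1"
          using True r1 rg by (intro mult_mono) auto
        also have "\<dots> = r powr \<gamma>" by (subst powr_add[symmetric]) simp
        finally show ?thesis using a C1 pos by (simp add: algebra_simps)
      next
        case False
        have "r = (r powr (\<gamma> - 1)) powr (1 / (\<gamma> - 1))"
          using \<gamma> r1 by (simp add: powr_powr)
        also have "\<dots> \<le> (2 * l\<^sup>2) powr (1 / (\<gamma> - 1))"
          using False \<gamma> by (intro powr_mono2) auto
        finally have "2 * l\<^sup>2 * r \<le> (2 * l\<^sup>2) powr 1 * (2 * l\<^sup>2) powr (1 / (\<gamma> - 1))"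
          using l1 by simp
        also have "\<dots> = (2 * l\<^sup>2) powr q" by (simp only: q(2) powr_add)
        also have "\<dots> = 2 powr q * l powr (2 * q)"
          using l1 by (simp add: powr_mult powr_powr flip: powr_numeral)
        also have "\<dots> \<le> 2 powr q * l powr (real n)"
          using l1 n0 by (intro mult_left_mono powr_mono) (auto simp: n_def)
        also have "\<dots> \<le> K * l ^ n"
          using l1 K by (simp add: powr_realpow mult_right_mono)
        finally have "2 * l\<^sup>2 * r \<le> K * l ^ n" .
        moreover have "0 \<le> C * excess \<gamma> (1 + r)" using C1 powr_ge_zero[of r \<gamma>] by linarith
        ultimately show ?thesis using a pos by (simp add: algebra_simps)
      qed
    qed
  qed
  moreover have "1 \<le> C"
  proof -
    have "0 \<le> 2 * (1 + R) / (\<gamma> - 1)" using R \<gamma> by simp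
    then show ?thesis using \<gamma> by (simp add: C_def)
  qed
  ultimately show ?thesis using that[of C K n] K by (simp add: n_def)
qed

text \<open>The source \<open>r v\<^sup>2 + excess\<close> dominates the momentum \<open>r v + r - 1\<close> superlinearly. The estimate
  is stated through its tangents, with slope \<open>l\<close>, since later \<open>l\<close> depends on time. Completing the
  square in \<open>v\<close> leaves \<open>(l + l\<^sup>2 / 4) (r - 1)\<close>, to which the previous lemma applies; the term
  \<open>l\<^sup>2 r\<close> created by the square is the reason for the exponent \<open>n\<close> there.\<close>

lemma flux_dominates_momentum:
  assumes \<gamma>: "1 < \<gamma>"
  obtains C K and n :: nat where "1 \<le> C" "1 \<le> K" "3 \<le> n"
    and "\<And>l r v. 0 \<le> l \<Longrightarrow> 0 < r \<Longrightarrow>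
          l * (r * v + r - 1) - K * (l\<^sup>2 + l ^ n) \<le> C * (r * v\<^sup>2 + excess \<gamma> r)"
proof -
  obtain C K and n :: nat where *: "1 \<le> C" "1 \<le> K" "3 \<le> n"
    and Y: "\<And>l r. 0 \<le> l \<Longrightarrow> 0 \<le> r \<Longrightarrow> (l + l\<^sup>2 / 4) * r \<le> C * excess \<gamma> (1 + r) + K * (l\<^sup>2 + l ^ n)"
    using density_young[OF \<gamma>] by metis
  have "l * (r * v + r - 1) - (K + 1) * (l\<^sup>2 + l ^ n) \<le> C * (r * v\<^sup>2 + excess \<gamma> r)"
    if l: "0 \<le> l" and r: "0 < r" for l r v
  proof -
    have "0 \<le> r * (v - l / 2)\<^sup>2" using r by simp
    then have "l * (r * v) \<le> r * v\<^sup>2 + l\<^sup>2 / 4 + l\<^sup>2 / 4 * (r - 1)"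
      by (simp add: power2_eq_square field_simps)
    then have 1: "l * (r * v) \<le> r * v\<^sup>2 + l\<^sup>2 + l\<^sup>2 / 4 * (r - 1)"
      using zero_le_power2[of l] by linarith
    have 2: "r * v\<^sup>2 \<le> C * (r * v\<^sup>2)" using * r mult_right_mono[of 1 C "r * v\<^sup>2"] by simp
    have 3: "(l + l\<^sup>2 / 4) * (r - 1) \<le> C * excess \<gamma> r + K * (l\<^sup>2 + l ^ n)"
    proof (cases "1 \<le> r")
      case True
      then show ?thesis using Y[OF l, of "r - 1"] by simp
    next
      case False
      then have "(l + l\<^sup>2 / 4) * (r - 1) \<le> 0" using l by (intro mult_nonneg_nonpos) auto
      moreover have "0 \<le> C * excess \<gamma> r" "0 \<le> K * (l\<^sup>2 + l ^ n)"
        using * l r excess_nonneg[OF \<gamma> r] by auto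
      ultimately show ?thesis by linarith
    qed
    have 4: "0 \<le> l ^ n" using l by simp
    show ?thesis using 1 2 3 4 by (simp add: algebra_simps)
  qed
  then show ?thesis using that[of C "K + 1" n] * by simp
qed

section \<open>Smooth test functions and the constant state\<close>

text \<open>A continuously differentiable function \<open>\<phi>\<close> with compact support in the slab, given together with its
  time derivative \<open>\<phi>\<^sub>t\<close> and its spatial gradient \<open>\<phi>\<^sub>x\<close>. Differentiability is required on the closed half
  space, in the two-sided sense at \<open>t = 0\<close>, so that the derivatives in the weak formulation
  are \<open>\<phi>\<^sub>t\<close> and \<open>\<phi>\<^sub>x\<close> at every point of the slab.\<close>

locale probe =
  fixes T T' R :: real and \<phi> :: "spacetime \<Rightarrow> real"
    and \<phi>\<^sub>t :: "spacetime \<Rightarrow> real" and \<phi>\<^sub>x :: "spacetime \<Rightarrow> space"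
  assumes times: "0 \<le> T'" "T' < T"
    and deriv: "\<And>z. 0 \<le> fst z \<Longrightarrow> (\<phi> has_derivative (\<lambda>h. fst h * \<phi>\<^sub>t z + snd h \<bullet> \<phi>\<^sub>x z)) (at z)"
    and cont_t: "continuous_on ({0..} \<times> UNIV) \<phi>\<^sub>t"
    and cont_x: "continuous_on ({0..} \<times> UNIV) \<phi>\<^sub>x"
    and supp: "\<And>z. 0 \<le> fst z \<Longrightarrow> T' \<le> fst z \<or> R \<le> norm (snd z)
                 \<Longrightarrow> \<phi> z = 0 \<and> \<phi>\<^sub>t z = 0 \<and> \<phi>\<^sub>x z = 0"
begin

definition cyl :: "spacetime set" where "cyl = {0..T'} \<times> cball 0 R"

lemma cyl: "compact cyl" "cyl \<subseteq> slab T" "cyl \<subseteq> {0..} \<times> UNIV"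
  using times by (auto simp: cyl_def slab_def intro!: compact_Times)

lemma zero_off_cyl:
  assumes "z \<in> slab T" "z \<notin> cyl"
  shows "\<phi> z = 0" "\<phi>\<^sub>t z = 0" "\<phi>\<^sub>x z = 0"
  using supp[of z] assms by (cases z; auto simp: cyl_def slab_def)+

lemma cont: "continuous_on ({0..} \<times> UNIV) \<phi>"
  by (rule has_derivative_continuous_on[OF has_derivative_at_withinI[OF deriv]]) auto

lemma lipschitz: "\<exists>L. lipschitz_on L (slab T) \<phi>"
proof -
  have "bounded (\<phi>\<^sub>t ` cyl)" "bounded (\<phi>\<^sub>x ` cyl)"
    using cyl by (auto intro!: compact_imp_bounded compact_continuous_image
        intro: continuous_on_subset[OF cont_t] continuous_on_subset[OF cont_x])
  then obtain A B where A: "\<And>z. z \<in> cyl \<Longrightarrow> \<bar>\<phi>\<^sub>t z\<bar> \<le> A" and B: "\<And>z. z \<in> cyl \<Longrightarrow> norm (\<phi>\<^sub>x z) \<le> B"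
    unfolding bounded_iff by auto
  define C where "C = \<bar>A\<bar> + \<bar>B\<bar>"
  have "C-lipschitz_on (slab T) \<phi>"
  proof (rule bounded_derivative_imp_lipschitz)
    show "convex (slab T)" by (auto simp: slab_def intro!: convex_Times)
    show "0 \<le> C" by (simp add: C_def)
    fix z assume z: "z \<in> slab T"
    show "(\<phi> has_derivative (\<lambda>h. fst h * \<phi>\<^sub>t z + snd h \<bullet> \<phi>\<^sub>x z)) (at z within slab T)"
      using z by (intro has_derivative_at_withinI[OF deriv]) (auto simp: slab_def)
    show "onorm (\<lambda>h. fst h * \<phi>\<^sub>t z + snd h \<bullet> \<phi>\<^sub>x z) \<le> C"
    proof (rule onorm_le)
      fix h :: spacetime
      have "\<bar>\<phi>\<^sub>t z\<bar> \<le> \<bar>A\<bar>" "norm (\<phi>\<^sub>x z) \<le> \<bar>B\<bar>"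
        using order_trans[OF A[of z] abs_ge_self] order_trans[OF B[of z] abs_ge_self] zero_off_cyl[OF z]
        by (cases "z \<in> cyl"; simp)+
      moreover have "\<bar>fst h\<bar> \<le> norm h" "norm (snd h) \<le> norm h"
        using norm_fst_le[of "fst h" "snd h"] norm_snd_le[of "snd h" "fst h"] by simp_all
      ultimately have "\<bar>fst h\<bar> * \<bar>\<phi>\<^sub>t z\<bar> \<le> norm h * \<bar>A\<bar>" "norm (snd h) * norm (\<phi>\<^sub>x z) \<le> norm h * \<bar>B\<bar>"
        by (auto intro!: mult_mono)
      moreover have "\<bar>snd h \<bullet> \<phi>\<^sub>x z\<bar> \<le> norm (snd h) * norm (\<phi>\<^sub>x z)"
        by (rule Cauchy_Schwarz_ineq2)
      ultimately show "norm (fst h * \<phi>\<^sub>t z + snd h \<bullet> \<phi>\<^sub>x z) \<le> C * norm h"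
        using abs_triangle_ineq[of "fst h * \<phi>\<^sub>t z" "snd h \<bullet> \<phi>\<^sub>x z"]
        by (simp add: C_def algebra_simps abs_mult)
    qed
  qed
  then show ?thesis ..
qed

lemma test_function: "test_function T \<phi>"
  unfolding test_function_def
proof (intro conjI exI[of _ cyl])
  show "compact cyl" "cyl \<subseteq> slab T" by (rule cyl)+
  show "\<forall>z\<in>slab T - cyl. \<phi> z = 0" by (simp add: zero_off_cyl)
qed (rule lipschitz)

lemma test_function_scaleR: "test_function T (\<lambda>z. \<phi> z *\<^sub>R (w::space))"
proof -
  obtain L where L: "lipschitz_on L (slab T) \<phi>" using lipschitz ..
  have "lipschitz_on (L * norm w) (slab T) (\<lambda>z. \<phi> z *\<^sub>R w)"
  proof (rule lipschitz_onI)
    show "0 \<le> L * norm w" using lipschitz_on_nonneg[OF L] by simp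
    fix y z assume "y \<in> slab T" "z \<in> slab T"
    from mult_right_mono[OF lipschitz_onD[OF L this] norm_ge_zero[of w]]
    show "dist (\<phi> y *\<^sub>R w) (\<phi> z *\<^sub>R w) \<le> L * norm w * dist y z"
      by (simp add: dist_norm mult_ac flip: scaleR_diff_left)
  qed
  then have "\<exists>L. lipschitz_on L (slab T) (\<lambda>z. \<phi> z *\<^sub>R w)" ..
  then show ?thesis
    unfolding test_function_def
  proof (intro conjI exI[of _ cyl])
    show "compact cyl" "cyl \<subseteq> slab T" by (rule cyl)+
    show "\<forall>z\<in>slab T - cyl. \<phi> z *\<^sub>R w = 0" by (simp add: zero_off_cyl)
  qed
qed

lemma derivatives:
  assumes "0 \<le> fst z"
  shows "dt \<phi> z = \<phi>\<^sub>t z" "grad \<phi> z = \<phi>\<^sub>x z"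
    "dt (\<lambda>z. \<phi> z *\<^sub>R w) z = \<phi>\<^sub>t z *\<^sub>R (w::space)"
    "divergence (\<lambda>z. \<phi> z *\<^sub>R w) z = w \<bullet> \<phi>\<^sub>x z"
    "tensor_grad v (\<lambda>z. \<phi> z *\<^sub>R w) z = (v \<bullet> \<phi>\<^sub>x z) * (v \<bullet> w)"
proof -
  note d = frechet_derivative_at[OF deriv[OF assms], symmetric]
  have d2: "frechet_derivative (\<lambda>z. \<phi> z *\<^sub>R w) (at z) = (\<lambda>h. (fst h * \<phi>\<^sub>t z + snd h \<bullet> \<phi>\<^sub>x z) *\<^sub>R w)"
    by (rule frechet_derivative_at[symmetric, OF has_derivative_scaleR_left[OF deriv[OF assms]]])
  have dx: "dx i (\<lambda>z. \<phi> z *\<^sub>R w) z = (\<phi>\<^sub>x z $ i) *\<^sub>R w" for i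
    by (simp add: dx_def d2 inner_axis' )
  show "dt \<phi> z = \<phi>\<^sub>t z" "grad \<phi> z = \<phi>\<^sub>x z" "dt (\<lambda>z. \<phi> z *\<^sub>R w) z = \<phi>\<^sub>t z *\<^sub>R w"
    by (simp_all add: dt_def grad_def dx_def d d2 inner_axis' vec_eq_iff)
  show "divergence (\<lambda>z. \<phi> z *\<^sub>R w) z = w \<bullet> \<phi>\<^sub>x z"
    by (simp add: divergence_def dx inner_vec_def mult.commute)
  show "tensor_grad v (\<lambda>z. \<phi> z *\<^sub>R w) z = (v \<bullet> \<phi>\<^sub>x z) * (v \<bullet> w)"
    unfolding tensor_grad_def dx inner_vec_def sum_product by (simp add: mult_ac)
qed

lemma integrable_cyl:
  fixes f :: "spacetime \<Rightarrow> 'b::{banach, second_countable_topology}"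
  assumes "continuous_on ({0..} \<times> UNIV) f"
  shows "integrable lborel (\<lambda>z. indicator cyl z *\<^sub>R f z)"
  by (rule borel_integrable_compact) (use assms cyl continuous_on_subset in blast)+

lemma slab_eq_cyl:
  fixes f :: "spacetime \<Rightarrow> 'b::real_vector"
  assumes "\<And>z. z \<in> slab T \<Longrightarrow> z \<notin> cyl \<Longrightarrow> f z = 0"
  shows "indicator (slab T) z *\<^sub>R f z = indicator cyl z *\<^sub>R f z"
  using assms[of z] cyl by (auto simp: indicator_def)

text \<open>The two following lemmas say that the constant state \<open>(1, 0)\<close> satisfies the weak equations.\<close>

lemma time_balance: "(LINT z:slab T|lebesgue. \<phi>\<^sub>t z) = - (LINT x|lebesgue. \<phi> (0, x))"
proof -
  have "(LINT z:slab T|lebesgue. \<phi>\<^sub>t z) = (LINT z|lebesgue. indicator cyl z *\<^sub>R \<phi>\<^sub>t z)"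
    unfolding set_lebesgue_integral_def by (subst slab_eq_cyl) (auto simp: zero_off_cyl)
  also have "\<dots> = (LINT z|lborel. indicator cyl z *\<^sub>R \<phi>\<^sub>t z)"
    using integrable_cyl[OF cont_t] by (intro integral_completion) auto
  also have "\<dots> = (LINT z|(lborel \<Otimes>\<^sub>M lborel). case_prod (\<lambda>t x. indicator cyl (t, x) *\<^sub>R \<phi>\<^sub>t (t, x)) z)"
    by (simp add: lborel_prod split_beta)
  also have "\<dots> = (LINT x|lborel. LINT t|lborel. indicator cyl (t, x) *\<^sub>R \<phi>\<^sub>t (t, x))"
    using integrable_cyl[OF cont_t] by (intro lborel_pair.integral_snd[symmetric]) (simp add: lborel_prod split_beta')
  also have "\<dots> = (LINT x|lborel. - \<phi> (0, x))"
  proof (intro Bochner_Integration.integral_cong refl)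
    fix x :: space
    have "(LINT t|lborel. indicator cyl (t, x) *\<^sub>R \<phi>\<^sub>t (t, x)) = (LINT t|lborel. indicator {0..T'} t *\<^sub>R \<phi>\<^sub>t (t, x))"
      using supp[of "(_, x)"] by (intro Bochner_Integration.integral_cong) (auto simp: cyl_def indicator_def)
    also have "\<dots> = \<phi> (T', x) - \<phi> (0, x)"
    proof (rule integral_FTC_Icc[OF times(1)])
      fix t assume t: "0 \<le> t" "t \<le> T'"
      have g: "((\<lambda>t. (t, x)) has_derivative (\<lambda>h. (h, 0))) (at t within {0..T'})"
        by (auto intro!: derivative_eq_intros)
      have "((\<lambda>t. \<phi> (t, x)) has_derivative (\<lambda>h. h * \<phi>\<^sub>t (t, x))) (at t within {0..T'})"
        using has_derivative_compose[OF g deriv[of "(t, x)"]] t by simp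
      then show "((\<lambda>t. \<phi> (t, x)) has_vector_derivative \<phi>\<^sub>t (t, x)) (at t within {0..T'})"
        by (simp add: has_vector_derivative_def)
    next
      show "continuous_on {0..T'} (\<lambda>t. \<phi>\<^sub>t (t, x))"
        by (rule continuous_on_compose2[OF cont_t]) (auto intro!: continuous_intros)
    qed
    also have "\<dots> = - \<phi> (0, x)" using supp[of "(T', x)"] times by simp
    finally show "(LINT t|lborel. indicator cyl (t, x) *\<^sub>R \<phi>\<^sub>t (t, x)) = - \<phi> (0, x)" .
  qed
  also have "\<dots> = - (LINT x|lborel. \<phi> (0, x))" by simp
  also have "(LINT x|lborel. \<phi> (0, x)) = (LINT x|lebesgue. \<phi> (0, x))"
  proof (rule integral_completion[symmetric])
    have "continuous_on UNIV (\<lambda>x. \<phi> (0, x))"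
      by (rule continuous_on_compose2[OF cont]) (auto intro!: continuous_intros)
    then show "(\<lambda>x. \<phi> (0, x)) \<in> borel_measurable lborel"
      by (simp add: borel_measurable_continuous_onI)
  qed
  finally show ?thesis by simp
qed

text \<open>Translation by \<open>w\<close> in space does not change the integral of \<open>\<phi>\<close> over the slab, and the difference
  of the two integrands is the integral of the directional derivative along the translation.\<close>

lemma space_balance: "(LINT z:slab T|lebesgue. w \<bullet> \<phi>\<^sub>x z) = 0"
proof -
  define G where "G z = indicator cyl z *\<^sub>R (w \<bullet> \<phi>\<^sub>x z)" for z
  define H where "H z = indicator cyl z *\<^sub>R \<phi> z" for z
  have G': "G z = indicator {0..T'} (fst z) * (w \<bullet> \<phi>\<^sub>x z)"
    and H': "H z = indicator {0..T'} (fst z) * \<phi> z" for z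
    using supp[of z] by (cases z; auto simp: G_def H_def cyl_def indicator_def)+
  have cw: "continuous_on ({0..} \<times> UNIV) (\<lambda>z. w \<bullet> \<phi>\<^sub>x z)"
    by (intro continuous_intros cont_x)
  have iG: "integrable lborel G" unfolding G_def by (rule integrable_cyl[OF cw])
  have iH: "integrable lborel H" unfolding H_def by (rule integrable_cyl[OF cont])
  have shift: "(LINT z|lborel. f (c + z)) = integral\<^sup>L lborel f" if "f \<in> borel_measurable borel"
    for f :: "spacetime \<Rightarrow> real" and c
    using integral_distr[of "(+) c" lborel borel f] that by (simp add: lborel_distr_plus)
  have ish: "integrable lborel (\<lambda>z. f (c + z))" if "integrable lborel f"
    for f :: "spacetime \<Rightarrow> real" and c
  proof -
    have "integrable (distr lborel borel ((+) c)) f" using that by (simp add: lborel_distr_plus)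
    then show ?thesis by (rule integrable_distr[rotated]) simp
  qed
  define c where "c r = r *\<^sub>R ((0, w)::spacetime)" for r :: real
  define S where "S = {0..1::real} \<times> ({0..T'} \<times> cball (0::space) (R + norm w))"
  define F where "F r z = indicator {0..1} r * G (c r + z)" for r z
  have FS: "case_prod F p = indicator S p *\<^sub>R (w \<bullet> \<phi>\<^sub>x (c (fst p) + snd p))" for p
  proof -
    obtain r t x where p: "p = (r, t, x)" by (cases p)
    have "\<phi>\<^sub>x (t, r *\<^sub>R w + x) = 0" if "0 \<le> r" "r \<le> 1" "0 \<le> t" "\<not> norm x \<le> R + norm w"
    proof -
      have "norm x \<le> norm (r *\<^sub>R w + x) + norm (r *\<^sub>R w)"
        using norm_triangle_ineq4[of "r *\<^sub>R w + x" "r *\<^sub>R w"] by simp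
      moreover have "norm (r *\<^sub>R w) \<le> norm w" using that by (simp add: mult_left_le_one_le)
      ultimately have "R \<le> norm (r *\<^sub>R w + x)" using that by linarith
      then show ?thesis using supp[of "(t, r *\<^sub>R w + x)"] that by simp
    qed
    then show ?thesis by (auto simp: p F_def S_def G' c_def indicator_def)
  qed
  have "integrable lborel (case_prod F)"
    unfolding FS
  proof (rule borel_integrable_compact)
    show "compact S" unfolding S_def by (intro compact_Times) auto
    show "continuous_on S (\<lambda>p. w \<bullet> \<phi>\<^sub>x (c (fst p) + snd p))"
      unfolding c_def
      by (rule continuous_on_compose2[OF cw]) (auto intro!: continuous_intros simp: S_def)
  qed
  then have iF: "integrable (lborel \<Otimes>\<^sub>M lborel) (case_prod F)" by (simp add: lborel_prod)
  have "(LINT z:slab T|lebesgue. w \<bullet> \<phi>\<^sub>x z) = (LINT z|lebesgue. G z)"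
    unfolding set_lebesgue_integral_def G_def by (subst slab_eq_cyl) (auto simp: zero_off_cyl)
  also have "\<dots> = integral\<^sup>L lborel G"
    using iG by (intro integral_completion) auto
  also have "\<dots> = (LINT r|lborel. indicator {0..1::real} r * integral\<^sup>L lborel G)"
    by simp
  also have "\<dots> = (LINT r|lborel. LINT z|lborel. F r z)"
    unfolding F_def using iG by (simp add: shift)
  also have "\<dots> = (LINT z|lborel. LINT r|lborel. F r z)"
    by (rule lborel_pair.Fubini_integral[OF iF, symmetric])
  also have "\<dots> = (LINT z|lborel. H (c 1 + z) - H z)"
  proof (intro Bochner_Integration.integral_cong refl)
    fix z :: spacetime
    obtain t x where z: "z = (t, x)" by (cases z)
    show "(LINT r|lborel. F r z) = H (c 1 + z) - H z"
    proof (cases "t \<in> {0..T'}")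
      case True
      have "(LINT r|lborel. F r z) = (LINT r|lborel. indicator {0..1} r *\<^sub>R (w \<bullet> \<phi>\<^sub>x (t, r *\<^sub>R w + x)))"
        using True by (simp add: F_def G' z c_def)
      also have "\<dots> = \<phi> (t, 1 *\<^sub>R w + x) - \<phi> (t, 0 *\<^sub>R w + x)"
      proof (rule integral_FTC_Icc)
        fix r :: real
        have g: "((\<lambda>r. (t, r *\<^sub>R w + x)) has_derivative (\<lambda>h. (0, h *\<^sub>R w))) (at r within {0..1})"
          by (auto intro!: derivative_eq_intros)
        have "((\<lambda>r. \<phi> (t, r *\<^sub>R w + x)) has_derivative (\<lambda>h. h * (w \<bullet> \<phi>\<^sub>x (t, r *\<^sub>R w + x)))) (at r within {0..1})"
          using has_derivative_compose[OF g deriv[of "(t, r *\<^sub>R w + x)"]] True by simp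
        then show "((\<lambda>r. \<phi> (t, r *\<^sub>R w + x)) has_vector_derivative w \<bullet> \<phi>\<^sub>x (t, r *\<^sub>R w + x)) (at r within {0..1})"
          by (simp add: has_vector_derivative_def)
      next
        show "continuous_on {0..1} (\<lambda>r. w \<bullet> \<phi>\<^sub>x (t, r *\<^sub>R w + x))"
          using True by (intro continuous_on_compose2[OF cw]) (auto intro!: continuous_intros)
      qed simp
      finally show ?thesis using True by (simp add: H' z c_def)
    qed (simp add: F_def G' H' z c_def)
  qed
  also have "\<dots> = (LINT z|lborel. H (c 1 + z)) - integral\<^sup>L lborel H"
    by (rule Bochner_Integration.integral_diff[OF ish[OF iH] iH])
  also have "\<dots> = 0" using iH by (simp add: shift)
  finally show ?thesis .
qed

end

section \<open>The balance law of a weak solution\<close>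

lemma Linf_on_scaleR:
  assumes f: "Linf_on S (f :: 'a::euclidean_space \<Rightarrow> real)" and g: "Linf_on S (g :: 'a \<Rightarrow> 'b::euclidean_space)"
  shows "Linf_on S (\<lambda>z. f z *\<^sub>R g z)"
proof -
  obtain A B where A: "AE z in lebesgue_on S. norm (f z) \<le> A" and B: "AE z in lebesgue_on S. norm (g z) \<le> B"
    using f g by (auto simp: Linf_on_def)
  have "AE z in lebesgue_on S. norm (f z *\<^sub>R g z) \<le> A * B"
    using A B
  proof eventually_elim
    case (elim z)
    then show ?case by (auto intro!: mult_mono order_trans[OF abs_ge_zero elim(1)[simplified]])
  qed
  then show ?thesis using f g by (auto simp: Linf_on_def)
qed

lemma Linf_on_inner:
  assumes "Linf_on S (f :: 'a::euclidean_space \<Rightarrow> 'b::euclidean_space)"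
  shows "Linf_on S (\<lambda>z. w \<bullet> f z)"
proof -
  obtain A where A: "AE z in lebesgue_on S. norm (f z) \<le> A"
    using assms by (auto simp: Linf_on_def)
  have "AE z in lebesgue_on S. norm (w \<bullet> f z) \<le> norm w * A"
    using A
  proof eventually_elim
    case (elim z)
    then show ?case
      using order_trans[OF Cauchy_Schwarz_ineq2 mult_left_mono[OF elim norm_ge_zero]] by simp
  qed
  then show ?thesis using assms by (auto simp: Linf_on_def)
qed

lemma Linf_on_pressure:
  assumes "Linf_on S (f :: 'a::euclidean_space \<Rightarrow> real)" "AE z in lebesgue_on S. 0 < f z" "0 < \<gamma>"
  shows "Linf_on S (\<lambda>z. pressure \<gamma> (f z))"
proof -
  obtain A where A: "AE z in lebesgue_on S. norm (f z) \<le> A"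
    using assms by (auto simp: Linf_on_def)
  have "AE z in lebesgue_on S. norm (pressure \<gamma> (f z)) \<le> A powr \<gamma> / \<gamma>"
    using A assms(2)
  proof eventually_elim
    case (elim z)
    then have "f z powr \<gamma> \<le> A powr \<gamma>" using assms(3) by (intro powr_mono2) auto
    then show ?case using assms(3) by (auto simp: pressure_def abs_mult divide_right_mono)
  qed
  then show ?thesis using assms(1) by (auto simp: Linf_on_def pressure_def)
qed

lemma Linf_on_inner_integrable:
  assumes f: "Linf_on S (f :: 'a::euclidean_space \<Rightarrow> 'b::euclidean_space)" and g: "integrable (lebesgue_on S) g"
  shows "integrable (lebesgue_on S) (\<lambda>z. f z \<bullet> g z)"
proof -
  obtain A where A: "AE z in lebesgue_on S. norm (f z) \<le> A"
    using f by (auto simp: Linf_on_def)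
  have "integrable (lebesgue_on S) (\<lambda>z. A * norm (g z))" using g by simp
  then show ?thesis
  proof (rule Bochner_Integration.integrable_bound)
    show "(\<lambda>z. f z \<bullet> g z) \<in> borel_measurable (lebesgue_on S)"
      using f g by (auto simp: Linf_on_def)
    show "AE z in lebesgue_on S. norm (f z \<bullet> g z) \<le> norm (A * norm (g z))"
      using A
    proof eventually_elim
      case (elim z)
      have "\<bar>f z \<bullet> g z\<bar> \<le> A * norm (g z)"
        using order_trans[OF Cauchy_Schwarz_ineq2 mult_right_mono[OF elim norm_ge_zero]] .
      then show ?case by simp
    qed
  qed
qed

lemma slab_lebesgue: "slab T \<in> sets lebesgue"
  by (simp add: slab_def borel_Times)

context probe
begin

lemma integrable_slab:
  fixes f :: "spacetime \<Rightarrow> 'b::{banach, second_countable_topology}"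
  assumes "continuous_on ({0..} \<times> UNIV) f" "\<And>z. z \<in> slab T \<Longrightarrow> z \<notin> cyl \<Longrightarrow> f z = 0"
  shows "integrable (lebesgue_on (slab T)) f"
proof -
  have "integrable lebesgue (\<lambda>z. indicator cyl z *\<^sub>R f z)"
    using integrable_cyl[OF assms(1)] by (simp add: integrable_completion)
  moreover have "(\<lambda>z. indicator cyl z *\<^sub>R f z) = (\<lambda>z. indicator (slab T) z *\<^sub>R f z)"
    by (intro ext slab_eq_cyl[symmetric] assms(2))
  ultimately have "integrable lebesgue (\<lambda>z. indicator (slab T) z *\<^sub>R f z)"
    by simp
  then show ?thesis
    using slab_lebesgue by (simp add: integrable_restrict_space)
qed

lemma integrable_initial: "integrable lebesgue (\<lambda>x. \<phi> (0, x))"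
proof -
  have "integrable lborel (\<lambda>x. indicator (cball 0 R) x *\<^sub>R \<phi> (0, x))"
    by (intro borel_integrable_compact continuous_on_compose2[OF cont]) (auto intro!: continuous_intros)
  moreover have "(\<lambda>x. indicator (cball 0 R) x *\<^sub>R \<phi> (0, x)) = (\<lambda>x. \<phi> (0, x))"
    using supp[of "(0, _)"] by (auto simp: indicator_def fun_eq_iff)
  ultimately have "integrable lborel (\<lambda>x. \<phi> (0, x))" by simp
  then show ?thesis by (simp add: integrable_completion)
qed

text \<open>The mass equation tested with \<open>\<phi>\<close> plus the momentum equation tested with \<open>\<phi> \<omega>\<close>, minus the same sum for
  the constant state \<open>(1, 0)\<close>. After this subtraction the integrand vanishes wherever the fluid is
  at rest with density \<open>1\<close>, whatever the test function does there.\<close>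

lemma momentum_flux_balance:
  fixes \<omega> :: space
  assumes sol: "weak_solution \<gamma> T \<rho> u \<rho>\<^sub>0 u\<^sub>0" and \<gamma>: "0 < \<gamma>"
  defines "J \<equiv> \<lambda>z. (\<omega> \<bullet> (\<rho> z *\<^sub>R u z) + \<rho> z - 1) * \<phi>\<^sub>t z
      + \<rho> z * (1 + \<omega> \<bullet> u z) * (u z \<bullet> \<phi>\<^sub>x z) + (pressure \<gamma> (\<rho> z) - 1 / \<gamma>) * (\<omega> \<bullet> \<phi>\<^sub>x z)"
  shows "integrable (lebesgue_on (slab T)) J"
    and "integral\<^sup>L (lebesgue_on (slab T)) J
      + (LINT x|lebesgue. (\<omega> \<bullet> (\<rho>\<^sub>0 x *\<^sub>R u\<^sub>0 x) + \<rho>\<^sub>0 x - 1) * \<phi> (0, x)) = 0"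
proof -
  let ?M = "lebesgue_on (slab T)"
  have L: "Linf_on (slab T) \<rho>" "Linf_on (slab T) u" "Linf_on UNIV \<rho>\<^sub>0" "Linf_on UNIV u\<^sub>0"
    and pos: "AE z in ?M. 0 < \<rho> z"
    and mass: "(LINT z:slab T|lebesgue. \<rho> z * dt \<phi> z + (\<rho> z *\<^sub>R u z) \<bullet> grad \<phi> z)
        + (LINT x|lebesgue. \<rho>\<^sub>0 x * \<phi> (0, x)) = 0"
    and mom: "\<And>\<psi>::spacetime \<Rightarrow> space. test_function T \<psi> \<Longrightarrow>
        (LINT z:slab T|lebesgue. (\<rho> z *\<^sub>R u z) \<bullet> dt \<psi> z
            + \<rho> z * tensor_grad (u z) \<psi> z + pressure \<gamma> (\<rho> z) * divergence \<psi> z)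
        + (LINT x|lebesgue. (\<rho>\<^sub>0 x *\<^sub>R u\<^sub>0 x) \<bullet> \<psi> (0, x)) = 0"
    using sol test_function unfolding weak_solution_def by blast+
  have set: "(LINT z:slab T|lebesgue. f z) = integral\<^sup>L ?M f" for f :: "spacetime \<Rightarrow> real"
    unfolding set_lebesgue_integral_def using slab_lebesgue by (simp add: integral_restrict_space)
  have nn: "0 \<le> fst z" if "z \<in> space ?M" for z using that by (auto simp: slab_def)
  have it: "integrable ?M \<phi>\<^sub>t" and ix: "integrable ?M \<phi>\<^sub>x" and iw: "integrable ?M (\<lambda>z. \<omega> \<bullet> \<phi>\<^sub>x z)"
    using zero_off_cyl by (auto intro!: integrable_slab cont_t cont_x continuous_intros)
  note S = Linf_on_scaleR and W = Linf_on_inner and I = Linf_on_inner_integrable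
  note \<rho>u = S[OF L(1) L(2)]
  have i1: "integrable ?M (\<lambda>z. \<rho> z * \<phi>\<^sub>t z)" using I[OF L(1) it] by simp
  have i2: "integrable ?M (\<lambda>z. (\<rho> z *\<^sub>R u z) \<bullet> \<phi>\<^sub>x z)" using I[OF \<rho>u ix] .
  have i3: "integrable ?M (\<lambda>z. (\<omega> \<bullet> (\<rho> z *\<^sub>R u z)) * \<phi>\<^sub>t z)" using I[OF W[OF \<rho>u] it] by simp
  have i4: "integrable ?M (\<lambda>z. \<rho> z * ((u z \<bullet> \<phi>\<^sub>x z) * (u z \<bullet> \<omega>)))"
    using I[OF S[OF W[OF L(2), of \<omega>] \<rho>u] ix] by (simp add: inner_commute mult_ac)
  have i5: "integrable ?M (\<lambda>z. pressure \<gamma> (\<rho> z) * (\<omega> \<bullet> \<phi>\<^sub>x z))"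
    using I[OF Linf_on_pressure[OF L(1) pos \<gamma>] iw] by simp
  have mass': "(LINT z|?M. \<rho> z * \<phi>\<^sub>t z + (\<rho> z *\<^sub>R u z) \<bullet> \<phi>\<^sub>x z) + (LINT x|lebesgue. \<rho>\<^sub>0 x * \<phi> (0, x)) = 0"
    using mass unfolding set
    by (subst (asm) Bochner_Integration.integral_cong[OF refl]) (auto simp: derivatives nn)
  have mom': "(LINT z|?M. (\<omega> \<bullet> (\<rho> z *\<^sub>R u z)) * \<phi>\<^sub>t z + \<rho> z * ((u z \<bullet> \<phi>\<^sub>x z) * (u z \<bullet> \<omega>))
        + pressure \<gamma> (\<rho> z) * (\<omega> \<bullet> \<phi>\<^sub>x z)) + (LINT x|lebesgue. (\<omega> \<bullet> (\<rho>\<^sub>0 x *\<^sub>R u\<^sub>0 x)) * \<phi> (0, x)) = 0"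
  proof -
    have a: "(LINT z|?M. (\<rho> z *\<^sub>R u z) \<bullet> dt (\<lambda>z. \<phi> z *\<^sub>R \<omega>) z
            + \<rho> z * tensor_grad (u z) (\<lambda>z. \<phi> z *\<^sub>R \<omega>) z + pressure \<gamma> (\<rho> z) * divergence (\<lambda>z. \<phi> z *\<^sub>R \<omega>) z)
       = (LINT z|?M. (\<omega> \<bullet> (\<rho> z *\<^sub>R u z)) * \<phi>\<^sub>t z + \<rho> z * ((u z \<bullet> \<phi>\<^sub>x z) * (u z \<bullet> \<omega>))
        + pressure \<gamma> (\<rho> z) * (\<omega> \<bullet> \<phi>\<^sub>x z))"
      by (intro Bochner_Integration.integral_cong refl)
         (simp add: derivatives[OF nn] inner_commute mult_ac)
    have b: "(LINT x|lebesgue. (\<rho>\<^sub>0 x *\<^sub>R u\<^sub>0 x) \<bullet> (\<phi> (0, x) *\<^sub>R \<omega>))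
        = (LINT x|lebesgue. (\<omega> \<bullet> (\<rho>\<^sub>0 x *\<^sub>R u\<^sub>0 x)) * \<phi> (0, x))"
      by (intro Bochner_Integration.integral_cong refl) (simp add: inner_commute mult_ac)
    show ?thesis using mom[OF test_function_scaleR[of \<omega>]] unfolding set a b .
  qed
  have J: "J = (\<lambda>z. (\<rho> z * \<phi>\<^sub>t z + (\<rho> z *\<^sub>R u z) \<bullet> \<phi>\<^sub>x z)
      + ((\<omega> \<bullet> (\<rho> z *\<^sub>R u z)) * \<phi>\<^sub>t z + \<rho> z * ((u z \<bullet> \<phi>\<^sub>x z) * (u z \<bullet> \<omega>)) + pressure \<gamma> (\<rho> z) * (\<omega> \<bullet> \<phi>\<^sub>x z))
      - \<phi>\<^sub>t z - (1 / \<gamma>) * (\<omega> \<bullet> \<phi>\<^sub>x z))"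
    by (auto simp: J_def fun_eq_iff algebra_simps inner_commute)
  show iJ: "integrable ?M J" unfolding J using i1 i2 i3 i4 i5 it iw by simp
  have iJ': "integral\<^sup>L ?M J = (LINT z|?M. \<rho> z * \<phi>\<^sub>t z + (\<rho> z *\<^sub>R u z) \<bullet> \<phi>\<^sub>x z)
      + (LINT z|?M. (\<omega> \<bullet> (\<rho> z *\<^sub>R u z)) * \<phi>\<^sub>t z + \<rho> z * ((u z \<bullet> \<phi>\<^sub>x z) * (u z \<bullet> \<omega>))
        + pressure \<gamma> (\<rho> z) * (\<omega> \<bullet> \<phi>\<^sub>x z))
      - integral\<^sup>L ?M \<phi>\<^sub>t - (1 / \<gamma>) * (LINT z|?M. \<omega> \<bullet> \<phi>\<^sub>x z)"
    unfolding J using i1 i2 i3 i4 i5 it iw by simp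
  have L0: "Linf_on UNIV f \<Longrightarrow> integrable lebesgue (\<lambda>x. f x * \<phi> (0, x))" for f :: "space \<Rightarrow> real"
    using I[of UNIV f "\<lambda>x. \<phi> (0, x)"] integrable_initial by (simp add: lebesgue_on_UNIV_eq)
  note k1 = L0[OF L(3)] and k2 = L0[OF W[OF S[OF L(3,4)], of \<omega>]]
  have N0: "(\<lambda>x. (\<omega> \<bullet> (\<rho>\<^sub>0 x *\<^sub>R u\<^sub>0 x) + \<rho>\<^sub>0 x - 1) * \<phi> (0, x))
      = (\<lambda>x. (\<omega> \<bullet> (\<rho>\<^sub>0 x *\<^sub>R u\<^sub>0 x)) * \<phi> (0, x) + \<rho>\<^sub>0 x * \<phi> (0, x) - \<phi> (0, x))"
    by (simp add: algebra_simps)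
  have "(LINT x|lebesgue. (\<omega> \<bullet> (\<rho>\<^sub>0 x *\<^sub>R u\<^sub>0 x) + \<rho>\<^sub>0 x - 1) * \<phi> (0, x))
      = (LINT x|lebesgue. (\<omega> \<bullet> (\<rho>\<^sub>0 x *\<^sub>R u\<^sub>0 x)) * \<phi> (0, x)) + (LINT x|lebesgue. \<rho>\<^sub>0 x * \<phi> (0, x))
        - (LINT x|lebesgue. \<phi> (0, x))"
    unfolding N0 using k1 k2 integrable_initial by simp
  then show "integral\<^sup>L ?M J
      + (LINT x|lebesgue. (\<omega> \<bullet> (\<rho>\<^sub>0 x *\<^sub>R u\<^sub>0 x) + \<rho>\<^sub>0 x - 1) * \<phi> (0, x)) = 0"
    using iJ' mass' mom' time_balance[unfolded set] space_balance[of \<omega>, unfolded set] by simp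
qed

end

section \<open>The region of influence\<close>

lemma Omega_closed: "closed (Omega \<omega> a b t)"
  unfolding Omega_def Omega_inf_def
  by (intro closed_Int closed_Collect_le continuous_intros)

text \<open>Rotate \<open>\<omega>\<close> to the first axis. The section then lies in a box of length \<open>1 - k\<close>; its half width \<open>r\<close> is
  limited by \<open>(1 + t)\<^sup>2 - (k + t)\<^sup>2 = (1 - k) (1 + k + 2 t)\<close>. Only the two transverse directions together
  produce growth in time, and this growth is linear: that is what makes the lifespan bound exponential.\<close>

lemma emeasure_Omega_le:
  assumes \<omega>: "norm \<omega> = 1" and k: "0 \<le> k" "k < 1" and t: "0 \<le> t"
  shows "emeasure lborel (Omega \<omega> k 1 t) \<le> ennreal (8 * (1 - k)\<^sup>2 * (1 + t))"
proof -
  obtain f :: "space \<Rightarrow> space" where f: "orthogonal_transformation f" and f1: "f (axis 1 1) = \<omega>"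
    by (rule orthogonal_transformation_exists_1[OF norm_axis_1[of 1] \<omega>])
  define r where "r = sqrt (2 * (1 - k) * (1 + t))"
  have r: "0 \<le> r" "r\<^sup>2 = 2 * (1 - k) * (1 + t)" using k t by (auto simp: r_def)
  define a b :: space where "a = vector [k + t, - r, - r]" and "b = vector [1 + t, r, r]"
  have sub: "Omega \<omega> k 1 t \<subseteq> f ` cbox a b"
  proof
    fix x assume x: "x \<in> Omega \<omega> k 1 t"
    obtain y where y: "x = f y" using orthogonal_transformation_surj[OF f] by (metis surjD)
    have "axis 1 1 \<bullet> y = \<omega> \<bullet> x"
      using f f1 y by (metis orthogonal_transformation_def)
    then have y1: "y $ 1 = \<omega> \<bullet> x" by (simp add: inner_axis')
    have ny: "norm y = norm x" using f y by (simp add: orthogonal_transformation_norm)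
    have l: "k + t \<le> y $ 1" and nx: "norm y \<le> 1 + t"
      using x y1 ny by (auto simp: Omega_def Omega_inf_def)
    have u: "y $ 1 \<le> 1 + t" using component_le_norm_cart[of y 1] nx by linarith
    have "(y $ 1)\<^sup>2 + (y $ 2)\<^sup>2 + (y $ 3)\<^sup>2 = (norm y)\<^sup>2"
      unfolding power2_norm_eq_inner inner_vec_def sum_3 by (simp add: power2_eq_square)
    also have "\<dots> \<le> (1 + t)\<^sup>2" using nx by (intro power_mono) auto
    finally have "(k + t)\<^sup>2 + (y $ 2)\<^sup>2 + (y $ 3)\<^sup>2 \<le> (1 + t)\<^sup>2"
      using power_mono[OF l, of 2] k t by simp
    moreover have "(1 + t)\<^sup>2 - (k + t)\<^sup>2 \<le> r\<^sup>2"
    proof -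
      have "(1 + t)\<^sup>2 - (k + t)\<^sup>2 = (1 - k) * (1 + k + 2 * t)" by (simp add: power2_eq_square algebra_simps)
      also have "\<dots> \<le> (1 - k) * (2 * (1 + t))" using k by (intro mult_left_mono) auto
      finally show ?thesis by (simp add: r algebra_simps)
    qed
    ultimately have "(y $ 2)\<^sup>2 \<le> r\<^sup>2" "(y $ 3)\<^sup>2 \<le> r\<^sup>2"
      using zero_le_power2[of "y $ 2"] zero_le_power2[of "y $ 3"] by linarith+
    then have "\<bar>y $ 2\<bar> \<le> r" "\<bar>y $ 3\<bar> \<le> r" using r(1) by (auto simp: abs_le_square_iff[symmetric])
    then have "y \<in> cbox a b"
      using l u by (auto simp: mem_box_cart a_def b_def forall_3)
    then show "x \<in> f ` cbox a b" using y by blast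
  qed
  have "a \<in> cbox a b"
    using k r by (simp add: mem_box_cart a_def b_def forall_3)
  then have ne: "cbox a b \<noteq> {}" by blast
  have "emeasure lborel (Omega \<omega> k 1 t) = emeasure lebesgue (Omega \<omega> k 1 t)"
    using Omega_closed by simp
  also have "\<dots> \<le> emeasure lebesgue (f ` cbox a b)"
    using measurable_orthogonal_image[OF f lmeasurable_cbox[of a b]]
    by (intro emeasure_mono sub) (auto simp: fmeasurable_def)
  also have "\<dots> = ennreal (measure lebesgue (f ` cbox a b))"
    using measurable_orthogonal_image[OF f lmeasurable_cbox[of a b]]
    by (intro emeasure_eq_measure2) 
  also have "measure lebesgue (f ` cbox a b) = measure lebesgue (cbox a b)"
    by (rule measure_orthogonal_image[OF f]) auto
  also have "\<dots> = (1 - k) * (2 * r) * (2 * r)"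
  proof -
    have "measure lebesgue (cbox a b) = (\<Prod>i\<in>UNIV. b $ i - a $ i)"
      using content_cbox_cart[OF ne] by simp
    also have "\<dots> = (b $ 1 - a $ 1) * (b $ 2 - a $ 2) * (b $ 3 - a $ 3)"
      unfolding UNIV_3 by simp
    finally show ?thesis by (simp add: a_def b_def)
  qed
  also have "\<dots> = 4 * (1 - k) * r\<^sup>2" by (simp add: power2_eq_square)
  also have "\<dots> = 8 * (1 - k)\<^sup>2 * (1 + t)" unfolding r by (simp add: power2_eq_square algebra_simps)
  finally show ?thesis .
qed

text \<open>The largest open set in the definition of the essential support is an uncountable union; by the
  Lindelof property countably many of its members suffice.\<close>

lemma ess_supp_AE:
  fixes f :: "'a::euclidean_space \<Rightarrow> 'b::zero"
  shows "AE z in lebesgue. z \<in> S - ess_supp S f \<longrightarrow> f z = 0"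
proof -
  define F where "F = {U. openin (top_of_set S) U \<and> (AE z in lebesgue. z \<in> U \<longrightarrow> f z = 0)}"
  obtain F' where F': "F' \<subseteq> F" "countable F'" "\<Union>F' = \<Union>F"
    using Lindelof_openin[of F S] by (auto simp: F_def)
  have "AE z in lebesgue. \<forall>U\<in>F'. z \<in> U \<longrightarrow> f z = 0"
    using F' by (intro AE_ball_countable') (auto simp: F_def)
  then show ?thesis
  proof eventually_elim
    case (elim z)
    then show ?case using F'(3) by (auto simp: ess_supp_def simp flip: F_def)
  qed
qed

lemma quiet_outside_support:
  assumes supp: "ess_supp (slab T) (\<lambda>z. (\<rho> z - 1, u z)) \<inter> spacetime_region T (Omega_inf \<omega> k\<^sub>0)
           \<subseteq> spacetime_region T (Omega \<omega> k\<^sub>0 1)" and k: "k\<^sub>0 \<le> k"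
  shows "AE z in lebesgue. z \<in> slab T \<longrightarrow> k + fst z \<le> \<omega> \<bullet> snd z \<longrightarrow> 1 + fst z < norm (snd z)
        \<longrightarrow> \<rho> z = (1::real) \<and> u z = (0::space)"
  using ess_supp_AE[of "slab T" "\<lambda>z. (\<rho> z - 1, u z)"]
proof eventually_elim
  case (elim z)
  show ?case
  proof (intro impI)
    assume z: "z \<in> slab T" "k + fst z \<le> \<omega> \<bullet> snd z" "1 + fst z < norm (snd z)"
    have "z \<in> spacetime_region T (Omega_inf \<omega> k\<^sub>0)"
      using z k by (auto simp: spacetime_region_def Omega_inf_def)
    moreover have "z \<notin> spacetime_region T (Omega \<omega> k\<^sub>0 1)"
      using z by (auto simp: spacetime_region_def Omega_def)
    ultimately have "z \<in> slab T - ess_supp (slab T) (\<lambda>z. (\<rho> z - 1, u z))"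
      using supp z(1) by blast
    then show "\<rho> z = 1 \<and> u z = 0" using elim by (auto simp: zero_prod_def)
  qed
qed

text \<open>The weight \<open>1 / (1 + t)\<^sup>2\<close> comes from the square of the logarithmic derivative of the
  weight in time. Against sections of volume of order \<open>1 + t\<close> it integrates to \<open>ln (1 + T')\<close>.\<close>

definition cone_weight :: "real \<Rightarrow> space \<Rightarrow> real \<Rightarrow> spacetime \<Rightarrow> real" where
  "cone_weight T' \<omega> k z = indicator {z. 0 \<le> fst z \<and> fst z \<le> T' \<and> snd z \<in> Omega \<omega> k 1 (fst z)} z / (1 + fst z)\<^sup>2"

lemma closed_cone: "closed {z::spacetime. 0 \<le> fst z \<and> fst z \<le> T' \<and> snd z \<in> Omega \<omega> k 1 (fst z)}"
  unfolding Omega_def Omega_inf_def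
  by (simp, intro closed_Collect_conj closed_Collect_le continuous_intros)

lemma cone_weight_measurable: "cone_weight T' \<omega> k \<in> borel_measurable borel"
  unfolding cone_weight_def using borel_closed[OF closed_cone]
  by (intro borel_measurable_divide borel_measurable_indicator
      borel_measurable_continuous_onI continuous_intros)

lemma nn_integral_cone_le:
  assumes \<omega>: "norm \<omega> = 1" and k: "0 \<le> k" "k < 1" and T': "0 < T'"
  shows "(\<integral>\<^sup>+ z. ennreal (cone_weight T' \<omega> k z) \<partial>lborel) \<le> ennreal (8 * (1 - k)\<^sup>2 * ln (1 + T'))"
proof -
  have m: "(\<lambda>z. ennreal (cone_weight T' \<omega> k z)) \<in> borel_measurable (borel :: spacetime measure)"
    using cone_weight_measurable by (rule measurable_compose[OF _ measurable_ennreal])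
  then have m': "(\<lambda>z. ennreal (cone_weight T' \<omega> k z)) \<in> borel_measurable (lborel \<Otimes>\<^sub>M lborel)"
    by (simp add: lborel_prod)
  have "(\<integral>\<^sup>+ z. ennreal (cone_weight T' \<omega> k z) \<partial>lborel)
      = (\<integral>\<^sup>+ z. ennreal (cone_weight T' \<omega> k z) \<partial>(lborel \<Otimes>\<^sub>M lborel))"
    by (simp add: lborel_prod)
  also have "\<dots> = (\<integral>\<^sup>+ t. \<integral>\<^sup>+ x. ennreal (cone_weight T' \<omega> k (t, x)) \<partial>lborel \<partial>lborel)"
    using m' by (rule lborel.nn_integral_fst[symmetric])
  also have "\<dots> \<le> (\<integral>\<^sup>+ t. ennreal (8 * (1 - k)\<^sup>2 * (1 / (1 + t))) * indicator {0..T'} t \<partial>lborel)"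
  proof (rule nn_integral_mono)
    fix t :: real
    show "(\<integral>\<^sup>+ x. ennreal (cone_weight T' \<omega> k (t, x)) \<partial>lborel)
        \<le> ennreal (8 * (1 - k)\<^sup>2 * (1 / (1 + t))) * indicator {0..T'} t"
    proof (cases "t \<in> {0..T'}")
      case True
      have "(\<integral>\<^sup>+ x. ennreal (cone_weight T' \<omega> k (t, x)) \<partial>lborel)
         = (\<integral>\<^sup>+ x. ennreal (1 / (1 + t)\<^sup>2) * indicator (Omega \<omega> k 1 t) x \<partial>lborel)"
        using True by (intro nn_integral_cong) (auto simp: cone_weight_def indicator_def)
      also have "\<dots> = ennreal (1 / (1 + t)\<^sup>2) * emeasure lborel (Omega \<omega> k 1 t)"
        using Omega_closed by (intro nn_integral_cmult_indicator) (simp add: borel_closed)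
      also have "\<dots> \<le> ennreal (1 / (1 + t)\<^sup>2) * ennreal (8 * (1 - k)\<^sup>2 * (1 + t))"
        using True by (intro mult_left_mono emeasure_Omega_le \<omega> k) auto
      also have "\<dots> = ennreal (8 * (1 - k)\<^sup>2 * (1 / (1 + t)))"
      proof -
        have "1 / (1 + t)\<^sup>2 * (8 * (1 - k)\<^sup>2 * (1 + t)) = 8 * (1 - k)\<^sup>2 * (1 / (1 + t))"
          using True by (simp add: power2_eq_square)
        then show ?thesis by (metis ennreal_mult' zero_le_divide_1_iff zero_le_power2)
      qed
      finally show ?thesis using True by simp
    next
      case False
      then have "cone_weight T' \<omega> k (t, x) = 0" for x by (auto simp: cone_weight_def)
      then show ?thesis by simp
    qed
  qed
  also have "\<dots> = ennreal (8 * (1 - k)\<^sup>2 * ln (1 + T') - 8 * (1 - k)\<^sup>2 * ln (1 + 0))"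
  proof (rule nn_integral_FTC_Icc[where F = "\<lambda>t. 8 * (1 - k)\<^sup>2 * ln (1 + t)"])
    show "0 \<le> T'" using T' by simp
    show "(\<lambda>t. 8 * (1 - k)\<^sup>2 * (1 / (1 + t))) \<in> borel_measurable borel" by measurable
    show "\<And>t. t \<in> {0..T'} \<Longrightarrow> ((\<lambda>t. 8 * (1 - k)\<^sup>2 * ln (1 + t)) has_real_derivative 8 * (1 - k)\<^sup>2 * (1 / (1 + t))) (at t)"
      by (auto intro!: derivative_eq_intros)
    show "\<And>t. t \<in> {0..T'} \<Longrightarrow> 0 \<le> 8 * (1 - k)\<^sup>2 * (1 / (1 + t))" by simp
  qed
  finally show ?thesis by simp
qed

section \<open>The truncated travelling wave\<close>

text \<open>At \<open>0\<close> the function is \<open>x\<close> times a continuous function that vanishes there.\<close>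

lemma has_real_derivative_pos_part_power:
  assumes "2 \<le> n"
  shows "((\<lambda>x. max x 0 ^ n) has_real_derivative n * max x 0 ^ (n - 1)) (at x)"
proof (rule linorder_cases[of x 0])
  assume "x < 0"
  have "((\<lambda>x. 0) has_real_derivative 0) (at x)" by simp
  then have "((\<lambda>x. max x 0 ^ n) has_real_derivative 0) (at x)"
    using \<open>x < 0\<close> assms
    by (elim has_field_derivative_transform_within_open[where S = "{..<0}"]) auto
  then show ?thesis using \<open>x < 0\<close> assms by (simp add: power_0_left)
next
  assume "0 < x"
  have "((\<lambda>x. x ^ n) has_real_derivative n * x ^ (n - 1)) (at x)"
    by (auto intro!: derivative_eq_intros)
  then have "((\<lambda>x. max x 0 ^ n) has_real_derivative n * x ^ (n - 1)) (at x)"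
    using \<open>0 < x\<close>
    by (elim has_field_derivative_transform_within_open[where S = "{0<..}"]) auto
  then show ?thesis using \<open>0 < x\<close> by simp
next
  assume x: "x = 0"
  have "max z 0 ^ n = max z 0 ^ (n - 1) * z" for z :: real
    using assms by (cases n) (auto simp: max_def)
  moreover have "isCont (\<lambda>z::real. max z 0 ^ (n - 1)) 0"
    by (intro continuous_intros)
  ultimately show ?thesis
    using x assms unfolding CARAT_DERIV
    by (intro exI[of _ "\<lambda>z. max z 0 ^ (n - 1)"]) (auto simp: power_0_left)
qed

text \<open>A \<open>C\<^sup>1\<close> cutoff, equal to \<open>1\<close> on the negative axis and to \<open>0\<close> beyond \<open>1\<close>.\<close>

definition bump :: "real \<Rightarrow> real" where
  "bump r = max (1 - (max r 0)\<^sup>2) 0 ^ 2"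

definition bump' :: "real \<Rightarrow> real" where
  "bump' r = - 4 * max (1 - (max r 0)\<^sup>2) 0 * max r 0"

lemma bump_deriv: "(bump has_real_derivative bump' r) (at r)"
proof -
  have "((\<lambda>r. max (1 - (max r 0)\<^sup>2) 0 ^ 2) has_real_derivative
      (real 2 * max (1 - (max r 0)\<^sup>2) 0 ^ (2 - 1)) * (0 - real 2 * max r 0 ^ (2 - 1))) (at r)"
    by (rule DERIV_chain2[where f = "\<lambda>x. max x 0 ^ 2"])
       (intro has_real_derivative_pos_part_power derivative_intros; simp)+
  then show ?thesis by (simp add: bump_def[abs_def] bump'_def mult.assoc)
qed

lemma bump_cases:
  "r \<le> 0 \<Longrightarrow> bump r = 1" "r \<le> 0 \<Longrightarrow> bump' r = 0" "1 \<le> r \<Longrightarrow> bump r = 0" "1 \<le> r \<Longrightarrow> bump' r = 0"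
  "0 \<le> bump r" "bump r \<le> 1"
proof -
  have "1 \<le> r \<Longrightarrow> 1 \<le> r\<^sup>2" by simp
  moreover have "max (1 - (max r 0)\<^sup>2) 0 ^ 2 \<le> 1" by (intro power_le_one) auto
  ultimately show "r \<le> 0 \<Longrightarrow> bump r = 1" "r \<le> 0 \<Longrightarrow> bump' r = 0" "1 \<le> r \<Longrightarrow> bump r = 0" "1 \<le> r \<Longrightarrow> bump' r = 0"
    "0 \<le> bump r" "bump r \<le> 1"
    by (auto simp: bump_def bump'_def max_def)
qed

lemma bump_cont: "continuous_on S f \<Longrightarrow> continuous_on S (\<lambda>x. bump (f x))"
  "continuous_on S f \<Longrightarrow> continuous_on S (\<lambda>x. bump' (f x))"
  unfolding bump_def bump'_def by (intro continuous_intros; assumption)+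

text \<open>The weight in time, a power of a function that decreases linearly from \<open>1\<close> to \<open>0\<close> in
  logarithmic time \<open>ln (1 + t)\<close>, over the logarithmic length \<open>L\<close>. The sections of the region of
  influence grow like \<open>1 + t\<close>, which makes \<open>ln (1 + t)\<close> the natural clock.\<close>

definition clock :: "nat \<Rightarrow> real \<Rightarrow> real \<Rightarrow> real" where
  "clock n L t = max (1 - ln (1 + t) / L) 0 ^ n"

definition clock' :: "nat \<Rightarrow> real \<Rightarrow> real \<Rightarrow> real" where
  "clock' n L t = - (n * max (1 - ln (1 + t) / L) 0 ^ (n - 1) / (L * (1 + t)))"

lemma clock_deriv:
  assumes "2 \<le> n" "0 \<le> t" "0 < L"
  shows "(clock n L has_real_derivative clock' n L t) (at t)"
proof -
  have "((\<lambda>t. 1 - ln (1 + t) / L) has_real_derivative - (1 / (L * (1 + t)))) (at t)"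
    using assms by (auto intro!: derivative_eq_intros)
  then have "((\<lambda>t. max (1 - ln (1 + t) / L) 0 ^ n) has_real_derivative
      (n * max (1 - ln (1 + t) / L) 0 ^ (n - 1)) * - (1 / (L * (1 + t)))) (at t)"
    by (rule DERIV_chain2[where f = "\<lambda>x. max x 0 ^ n", OF has_real_derivative_pos_part_power[OF assms(1)]])
  then show ?thesis by (simp add: clock_def[abs_def] clock'_def)
qed

text \<open>The truncated wave \<open>(\<omega> \<bullet> x - t - k)\<^sup>2 / 2\<close>, which travels with sound speed, weighted in time and cut
  off to a neighbourhood of width about \<open>\<epsilon>\<close> of the ball \<open>norm x \<le> 1 + t\<close>. The cutoff is constant inside this
  moving ball, so its derivatives live where the solution is at rest. Using \<open>x \<bullet> x\<close> and not the norm keeps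
  the cutoff smooth.\<close>

definition wave :: "nat \<Rightarrow> real \<Rightarrow> space \<Rightarrow> real \<Rightarrow> real \<Rightarrow> spacetime \<Rightarrow> real" where
  "wave n L \<omega> k \<epsilon> z = clock n L (fst z) * ((max (\<omega> \<bullet> snd z - fst z - k) 0)\<^sup>2 / 2)
      * bump ((snd z \<bullet> snd z - (1 + fst z)\<^sup>2) / \<epsilon>)"

definition wave_t :: "nat \<Rightarrow> real \<Rightarrow> space \<Rightarrow> real \<Rightarrow> real \<Rightarrow> spacetime \<Rightarrow> real" where
  "wave_t n L \<omega> k \<epsilon> z = (let s = max (\<omega> \<bullet> snd z - fst z - k) 0; q = (snd z \<bullet> snd z - (1 + fst z)\<^sup>2) / \<epsilon>
      in (clock' n L (fst z) * (s\<^sup>2 / 2) - clock n L (fst z) * s) * bump q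
         - clock n L (fst z) * (s\<^sup>2 / 2) * (bump' q * (2 * (1 + fst z) / \<epsilon>)))"

definition wave_x :: "nat \<Rightarrow> real \<Rightarrow> space \<Rightarrow> real \<Rightarrow> real \<Rightarrow> spacetime \<Rightarrow> space" where
  "wave_x n L \<omega> k \<epsilon> z = (let s = max (\<omega> \<bullet> snd z - fst z - k) 0; q = (snd z \<bullet> snd z - (1 + fst z)\<^sup>2) / \<epsilon>
      in (clock n L (fst z) * s * bump q) *\<^sub>R \<omega>
         + (clock n L (fst z) * (s\<^sup>2 / 2) * (bump' q * (2 / \<epsilon>))) *\<^sub>R snd z)"

lemma wave_has_derivative:
  assumes "2 \<le> n" "0 \<le> fst z" "0 < L" "0 < \<epsilon>"
  shows "(wave n L \<omega> k \<epsilon> has_derivative (\<lambda>h. fst h * wave_t n L \<omega> k \<epsilon> z + snd h \<bullet> wave_x n L \<omega> k \<epsilon> z)) (at z)"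
proof -
  define S where "S y = \<omega> \<bullet> snd y - fst y - k" for y :: spacetime
  define Q where "Q y = (snd y \<bullet> snd y - (1 + fst y)\<^sup>2) / \<epsilon>" for y :: spacetime
  have c: "((\<lambda>y. clock n L (fst y)) has_derivative (\<lambda>h. fst h * clock' n L (fst z))) (at z)"
    using has_derivative_compose[OF has_derivative_fst[OF has_derivative_ident]
        clock_deriv[OF assms(1-3), unfolded has_field_derivative_def]]
    by (simp add: mult.commute)
  have S: "(S has_derivative (\<lambda>h. \<omega> \<bullet> snd h - fst h)) (at z)"
    unfolding S_def by (auto intro!: derivative_eq_intros)
  have p: "((\<lambda>y. (max (S y) 0)\<^sup>2 / 2) has_derivative (\<lambda>h. (\<omega> \<bullet> snd h - fst h) * max (S z) 0)) (at z)"
    using has_derivative_divide[OF has_derivative_compose[OF S has_real_derivative_pos_part_power[of 2 "S z", unfolded has_field_derivative_def]]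
        has_derivative_const[of 2]]
    by (simp add: mult.commute)
  have Q: "(Q has_derivative (\<lambda>h. (2 * (snd h \<bullet> snd z) - 2 * (1 + fst z) * fst h) / \<epsilon>)) (at z)"
    unfolding Q_def using assms(4)
    by (auto intro!: derivative_eq_intros simp: inner_commute power2_eq_square field_simps fun_eq_iff)
  have b: "((\<lambda>y. bump (Q y)) has_derivative (\<lambda>h. (2 * (snd h \<bullet> snd z) - 2 * (1 + fst z) * fst h) / \<epsilon> * bump' (Q z))) (at z)"
    using has_derivative_compose[OF Q bump_deriv[of "Q z", unfolded has_field_derivative_def]]
    by (simp add: mult.commute)
  have "((\<lambda>y. clock n L (fst y) * ((max (S y) 0)\<^sup>2 / 2) * bump (Q y)) has_derivative
     (\<lambda>h. fst h * wave_t n L \<omega> k \<epsilon> z + snd h \<bullet> wave_x n L \<omega> k \<epsilon> z)) (at z)"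
    by (rule has_derivative_eq_rhs[OF has_derivative_mult[OF has_derivative_mult[OF c p] b]])
       (simp add: fun_eq_iff wave_t_def wave_x_def Let_def flip: S_def Q_def,
        simp add: algebra_simps inner_commute diff_divide_distrib add_divide_distrib)
  then show ?thesis by (simp add: wave_def[abs_def] S_def Q_def)
qed

lemma wave_probe:
  assumes n: "2 \<le> n" and T': "0 < T'" "T' < T" and \<epsilon>: "0 < \<epsilon>"
  defines "L \<equiv> ln (1 + T')"
  shows "probe T T' (1 + T' + \<epsilon>) (wave n L \<omega> k \<epsilon>) (wave_t n L \<omega> k \<epsilon>) (wave_x n L \<omega> k \<epsilon>)"
proof
  have L: "0 < L" using T' by (simp add: L_def)
  show "0 \<le> T'" "T' < T" using T' by auto
  show "(wave n L \<omega> k \<epsilon> has_derivative (\<lambda>h. fst h * wave_t n L \<omega> k \<epsilon> z + snd h \<bullet> wave_x n L \<omega> k \<epsilon> z)) (at z)"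
    if "0 \<le> fst z" for z
    using wave_has_derivative[OF n that L \<epsilon>] .
  have ln: "continuous_on ({0..} \<times> UNIV) (\<lambda>z::spacetime. ln (1 + fst z))"
    by (intro continuous_on_ln continuous_intros) auto
  have "continuous_on ({0..} \<times> UNIV) (\<lambda>z::spacetime. clock n L (fst z))"
       "continuous_on ({0..} \<times> UNIV) (\<lambda>z::spacetime. clock' n L (fst z))"
    unfolding clock_def clock'_def using L by (auto intro!: continuous_intros ln)
  then show "continuous_on ({0..} \<times> UNIV) (wave_t n L \<omega> k \<epsilon>)"
     "continuous_on ({0..} \<times> UNIV) (wave_x n L \<omega> k \<epsilon>)"
    unfolding wave_t_def wave_x_def Let_def using \<epsilon>
    by (auto intro!: continuous_intros bump_cont)
  fix z :: spacetime
  assume z0: "0 \<le> fst z" and "T' \<le> fst z \<or> 1 + T' + \<epsilon> \<le> norm (snd z)"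
  then consider "T' \<le> fst z" | "fst z < T'" "1 + T' + \<epsilon> \<le> norm (snd z)" by linarith
  then show "wave n L \<omega> k \<epsilon> z = 0 \<and> wave_t n L \<omega> k \<epsilon> z = 0 \<and> wave_x n L \<omega> k \<epsilon> z = 0"
  proof cases
    case 1
    then have "L \<le> ln (1 + fst z)" using T' by (simp add: L_def)
    then have "clock n L (fst z) = 0" "clock' n L (fst z) = 0"
      using L n by (auto simp: clock_def clock'_def max_def power_0_left)
    then show ?thesis by (simp add: wave_def wave_t_def wave_x_def)
  next
    case 2
    have "(1 + fst z)\<^sup>2 + \<epsilon> \<le> (1 + T')\<^sup>2 + \<epsilon>"
      using z0 2 by simp
    also have "\<dots> \<le> (1 + T' + \<epsilon>)\<^sup>2"
      using \<epsilon> T' by (simp add: power2_eq_square algebra_simps)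
    also have "\<dots> \<le> (norm (snd z))\<^sup>2" using 2 \<epsilon> T' by (intro power_mono) auto
    finally have "1 \<le> (snd z \<bullet> snd z - (1 + fst z)\<^sup>2) / \<epsilon>"
      using \<epsilon> by (simp add: power2_norm_eq_inner field_simps)
    then show ?thesis by (simp add: wave_def wave_t_def wave_x_def bump_cases)
  qed
qed

text \<open>At \<open>t = 0\<close> the cutoff tends to the indicator function of the unit ball, which together with \<open>\<omega> \<bullet> x > k\<close> gives
  the domain of integration of \<open>w0\<close>. For \<open>\<epsilon> \<le> 1\<close> the truncated waves live in the ball of radius \<open>2\<close>, whence the
  dominating function.\<close>

lemma wave_initial_limit:
  assumes f: "Linf_on UNIV (f :: space \<Rightarrow> real)" and \<omega>: "norm \<omega> = 1" and k: "0 \<le> k"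
  shows "(\<lambda>j. LINT x|lebesgue. f x * wave n L \<omega> k (1 / real (Suc j)) (0, x))
      \<longlonglongrightarrow> 1/2 * (LINT x:Omega \<omega> k 1 0|lebesgue. f x * (\<omega> \<bullet> x - k)\<^sup>2)"
proof -
  have fm: "f \<in> borel_measurable lebesgue"
    using f by (simp add: Linf_on_def lebesgue_on_UNIV_eq)
  obtain M where "AE x in lebesgue_on UNIV. norm (f x) \<le> M"
    using f unfolding Linf_on_def by blast
  then have M: "AE x in lebesgue. \<bar>f x\<bar> \<le> M"
    unfolding lebesgue_on_UNIV_eq by simp
  define g where "g x = f x * (indicator (Omega \<omega> k 1 0) x * (\<omega> \<bullet> x - k)\<^sup>2 / 2)" for x
  have Om: "Omega \<omega> k 1 0 \<in> sets lebesgue" using Omega_closed by (simp add: borel_closed)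
  have wm: "(\<lambda>x. wave n L \<omega> k \<epsilon> (0, x)) \<in> borel_measurable lebesgue" for \<epsilon>
    unfolding wave_def bump_def by (intro measurable_completion) simp
  have wv: "wave n L \<omega> k \<epsilon> (0, x) = (max (\<omega> \<bullet> x - k) 0)\<^sup>2 / 2 * bump ((x \<bullet> x - 1) / \<epsilon>)" for \<epsilon> x
    by (simp add: wave_def clock_def)
  have "(\<lambda>j. LINT x|lebesgue. f x * wave n L \<omega> k (1 / real (Suc j)) (0, x)) \<longlonglongrightarrow> integral\<^sup>L lebesgue g"
  proof (rule integral_dominated_convergence[where w = "\<lambda>x. M * (2 * indicator (cball 0 2) x)"])
    show "g \<in> borel_measurable lebesgue"
      unfolding g_def using fm Om by (intro borel_measurable_times borel_measurable_divide) (auto intro!: measurable_completion)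
    show "(\<lambda>x. f x * wave n L \<omega> k (1 / real (Suc j)) (0, x)) \<in> borel_measurable lebesgue" for j
      using fm wm by (rule borel_measurable_times)
    show "integrable lebesgue (\<lambda>x::space. M * (2 * indicator (cball 0 2) x))"
      by (intro integrable_mult_right) (simp add: lmeasurable_iff_integrable[symmetric])
    show "AE x in lebesgue. (\<lambda>j. f x * wave n L \<omega> k (1 / real (Suc j)) (0, x)) \<longlonglongrightarrow> g x"
    proof (rule AE_I2)
      fix x :: space
      show "(\<lambda>j. f x * wave n L \<omega> k (1 / real (Suc j)) (0, x)) \<longlonglongrightarrow> g x"
      proof (cases "norm x \<le> 1")
        case True
        then have "x \<bullet> x \<le> 1" by (simp add: power2_norm_eq_inner[symmetric] power_le_one)
        then have "bump ((x \<bullet> x - 1) / (1 / real (Suc j))) = 1" for j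
          by (intro bump_cases) (simp add: mult_nonpos_nonneg)
        then have "(\<lambda>j. f x * wave n L \<omega> k (1 / real (Suc j)) (0, x)) = (\<lambda>j. g x)"
          using True by (auto simp: wv g_def Omega_def Omega_inf_def indicator_def max_def)
        then show ?thesis by simp
      next
        case False
        then have x: "0 < x \<bullet> x - 1" by (simp add: power2_norm_eq_inner[symmetric] power2_eq_square) (smt (verit) mult_less_cancel_left2)
        obtain j0 :: nat where j0: "1 / (x \<bullet> x - 1) \<le> real j0" using real_arch_simple by blast
        have "\<forall>\<^sub>F j in sequentially. f x * wave n L \<omega> k (1 / real (Suc j)) (0, x) = g x"
        proof (rule eventually_sequentiallyI[of j0])
          fix j assume "j0 \<le> j"
          then have "1 / (x \<bullet> x - 1) \<le> real (Suc j)" using j0 by linarith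
          then have "1 \<le> (x \<bullet> x - 1) / (1 / real (Suc j))" using x by (simp add: field_simps)
          then show "f x * wave n L \<omega> k (1 / real (Suc j)) (0, x) = g x"
            using False bump_cases(3) by (simp add: wv g_def Omega_def)
        qed
        then show ?thesis by (rule tendsto_eventually)
      qed
    qed
    show "AE x in lebesgue. norm (f x * wave n L \<omega> k (1 / real (Suc j)) (0, x)) \<le> M * (2 * indicator (cball 0 2) x)" for j
      using M
    proof eventually_elim
      case (elim x)
      have w0: "0 \<le> wave n L \<omega> k (1 / real (Suc j)) (0, x)" unfolding wv by (simp add: bump_cases)
      have "wave n L \<omega> k (1 / real (Suc j)) (0, x) \<le> 2 * indicator (cball 0 2) x"
      proof (cases "norm x \<le> 2")
        case True
        have "\<bar>\<omega> \<bullet> x\<bar> \<le> 2" using Cauchy_Schwarz_ineq2[of \<omega> x] \<omega> True by simp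
        then have "max (\<omega> \<bullet> x - k) 0 \<le> 2" using k by auto
        then have "(max (\<omega> \<bullet> x - k) 0)\<^sup>2 \<le> 2\<^sup>2" by (intro power_mono) auto
        then have "(max (\<omega> \<bullet> x - k) 0)\<^sup>2 / 2 * bump ((x \<bullet> x - 1) / (1 / real (Suc j))) \<le> 2 * 1"
          by (intro mult_mono) (auto simp: bump_cases)
        then show ?thesis using True by (simp add: wv)
      next
        case False
        then have "2\<^sup>2 \<le> (norm x)\<^sup>2" by (intro power_mono) auto
        then have "1 \<le> x \<bullet> x - 1" by (simp add: power2_norm_eq_inner)
        moreover have "(x \<bullet> x - 1) * 1 \<le> (x \<bullet> x - 1) * real (Suc j)"
          using \<open>1 \<le> x \<bullet> x - 1\<close> by (intro mult_left_mono) auto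
        ultimately have "1 \<le> (x \<bullet> x - 1) * real (Suc j)"
          by (metis mult.right_neutral order_trans)
        then have "1 \<le> (x \<bullet> x - 1) / (1 / real (Suc j))" by simp
        then show ?thesis using bump_cases(3) by (simp add: wv)
      qed
      then have "\<bar>f x\<bar> * wave n L \<omega> k (1 / real (Suc j)) (0, x) \<le> M * (2 * indicator (cball 0 2) x)"
        using elim w0 by (intro mult_mono) auto
      then show ?case using w0 by (simp add: abs_mult)
    qed
  qed
  also have "integral\<^sup>L lebesgue g = 1/2 * (LINT x:Omega \<omega> k 1 0|lebesgue. f x * (\<omega> \<bullet> x - k)\<^sup>2)"
    unfolding set_lebesgue_integral_def g_def
    by (simp flip: integral_mult_right_zero) (simp add: mult_ac)
  finally show ?thesis .
qed

section \<open>The bound for the initial moment\<close>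

text \<open>Here \<open>N\<close> is the momentum excess and \<open>e\<close> the source at one point. The weight decreases, so its
  derivative contributes \<open>N\<close> with the unfavourable sign. The slope \<open>l\<close> of the tangent estimate for \<open>e\<close> is
  chosen as \<open>- C \<delta> clock' / (2 clock)\<close>, which makes the two terms in \<open>N\<close> cancel exactly
  once \<open>s\<close> is bounded below by \<open>s\<^sup>2 / \<delta>\<close>. What remains does not involve the solution.\<close>

lemma clock_lower_bound:
  fixes C K \<delta> L N e s t :: real and n :: nat
  assumes dom: "\<And>l. 0 \<le> l \<Longrightarrow> l * N - K * (l\<^sup>2 + l ^ n) \<le> C * e" and e: "0 \<le> e"
    and C: "0 < C" and K: "0 \<le> K" and n: "2 \<le> n" and L: "0 < L" and t: "0 \<le> t"
    and s: "0 \<le> s" "s \<le> \<delta>" and \<delta>: "0 < \<delta>"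
  defines "\<kappa> \<equiv> C * n / 2"
  shows "- (\<delta> * K / C * ((\<kappa> * \<delta> / L)\<^sup>2 + (\<kappa> * \<delta> / L) ^ n) / (1 + t)\<^sup>2)
     \<le> clock' n L t * (s\<^sup>2 / 2) * N + clock n L t * s * e"
proof (cases "1 - ln (1 + t) / L \<le> 0")
  case True
  have "0 \<le> \<kappa>" using C by (simp add: \<kappa>_def)
  then have "0 \<le> \<delta> * K / C * ((\<kappa> * \<delta> / L)\<^sup>2 + (\<kappa> * \<delta> / L) ^ n) / (1 + t)\<^sup>2"
    using C K L \<delta> by simp
  then show ?thesis using True n by (simp add: clock_def clock'_def max_def power_0_left)
next
  case False
  define m where "m = 1 - ln (1 + t) / L"
  have m: "0 < m" "m \<le> 1" using False L t by (auto simp: m_def)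
  define \<theta> where "\<theta> = m ^ n"
  have \<theta>: "clock n L t = \<theta>" "0 \<le> \<theta>" using m by (auto simp: clock_def \<theta>_def m_def)
  have \<theta>': "clock' n L t = - (n * m ^ (n - 1) / (L * (1 + t)))"
    using m by (simp add: clock'_def m_def)
  define b where "b = \<kappa> * \<delta> / L"
  have b: "0 \<le> b" using C L \<delta> by (simp add: b_def \<kappa>_def)
  define l where "l = b / ((1 + t) * m)"
  have l: "0 \<le> l" using b m t by (simp add: l_def)
  have mn: "m ^ n = m ^ (n - 1) * m" using n by (cases n) auto
  have half: "clock' n L t / 2 = - (\<theta> * l / (\<delta> * C))"
  proof -
    have "p * m * (C * n / 2 * \<delta> / L / (a * m)) / (\<delta> * C) = n * p / (L * a) / 2" if "0 < a" for a p :: real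
      using that C L \<delta> m by (simp add: field_simps)
    from this[of "1 + t" "m ^ (n - 1)"] show ?thesis
      using t by (simp add: \<theta>' \<theta>_def mn l_def b_def \<kappa>_def)
  qed
  have s2: "s\<^sup>2 / \<delta> \<le> s" using s \<delta> mult_left_mono[of s \<delta> s] by (simp add: power2_eq_square field_simps)
  have s3: "s\<^sup>2 \<le> \<delta>\<^sup>2" using s by (intro power_mono) auto
  have "\<theta> * (s\<^sup>2 / (\<delta> * C)) * (l * N - K * (l\<^sup>2 + l ^ n)) \<le> \<theta> * (s\<^sup>2 / (\<delta> * C)) * (C * e)"
    using dom[OF l] \<theta> \<delta> C by (intro mult_left_mono) auto
  also have "\<dots> = \<theta> * (s\<^sup>2 / \<delta>) * e" using C by simp
  also have "\<dots> \<le> \<theta> * s * e" using s2 \<theta> e by (intro mult_right_mono mult_left_mono) auto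
  finally have 1: "\<theta> * (s\<^sup>2 / (\<delta> * C)) * (l * N - K * (l\<^sup>2 + l ^ n)) \<le> \<theta> * s * e" .
  have 2: "clock' n L t * (s\<^sup>2 / 2) * N = - (\<theta> * (s\<^sup>2 / (\<delta> * C)) * (l * N))"
    using half by (simp add: field_simps)
  \<comment> \<open>The weight is the power \<open>n\<close> of \<open>m\<close> just so that it cancels the poles of \<open>l\<^sup>2\<close> and \<open>l ^ n\<close> at \<open>m = 0\<close>.\<close>
  have "\<theta> * l\<^sup>2 = m ^ (n - 2) * (b / (1 + t))\<^sup>2"
    using m n le_add_diff_inverse2[OF n] power_add[of m "n - 2" 2]
    by (simp add: \<theta>_def l_def power_divide power_mult_distrib)
  also have "\<dots> \<le> 1 * (b / (1 + t))\<^sup>2"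
    using m by (intro mult_right_mono power_le_one) auto
  finally have l2: "\<theta> * l\<^sup>2 \<le> b\<^sup>2 / (1 + t)\<^sup>2" by (simp add: power_divide)
  have "\<theta> * l ^ n = b ^ n / (1 + t) ^ n"
    using m by (simp add: \<theta>_def l_def power_divide power_mult_distrib)
  also have "\<dots> \<le> b ^ n / (1 + t)\<^sup>2"
    using b t n by (intro divide_left_mono power_increasing) auto
  finally have "\<theta> * (l\<^sup>2 + l ^ n) \<le> (b\<^sup>2 + b ^ n) / (1 + t)\<^sup>2"
    using l2 by (simp add: algebra_simps add_divide_distrib)
  then have "s\<^sup>2 / (\<delta> * C) * K * (\<theta> * (l\<^sup>2 + l ^ n)) \<le> \<delta>\<^sup>2 / (\<delta> * C) * K * ((b\<^sup>2 + b ^ n) / (1 + t)\<^sup>2)"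
    using s3 K C \<delta> \<theta> l by (intro mult_mono divide_right_mono) auto
  also have "\<dots> = \<delta> * K / C * (b\<^sup>2 + b ^ n) / (1 + t)\<^sup>2"
    using \<delta> by (simp add: power2_eq_square)
  finally show ?thesis
    using 1 2 by (simp add: \<theta> b_def algebra_simps)
qed

text \<open>The balance law, tested with the truncated wave, has an integrand that is bounded below by
  \<open>- A / (1 + t)\<^sup>2\<close> inside the region of influence and vanishes outside; the volume of this region
  bounds the initial moment, first of the truncated wave and then, as \<open>\<epsilon> \<rightarrow> 0\<close>, of \<open>w0\<close>.\<close>

lemma moment_bound:
  fixes \<gamma> T :: real and \<rho> u \<rho>\<^sub>0 u\<^sub>0 \<omega> C K and n :: nat
  assumes \<gamma>: "1 < \<gamma>" and sol: "weak_solution \<gamma> T \<rho> u \<rho>\<^sub>0 u\<^sub>0" and \<omega>: "norm \<omega> = 1"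
    and k: "0 \<le> k" "k < 1" and T': "0 < T'" "T' < T"
    and quiet: "AE z in lebesgue. z \<in> slab T \<longrightarrow> k + fst z \<le> \<omega> \<bullet> snd z \<longrightarrow> 1 + fst z < norm (snd z)
        \<longrightarrow> \<rho> z = 1 \<and> u z = 0"
    and C: "0 < C" and K: "0 \<le> K" and n: "2 \<le> n"
    and dom: "\<And>l r v. 0 \<le> l \<Longrightarrow> 0 < r \<Longrightarrow>
          l * (r * v + r - 1) - K * (l\<^sup>2 + l ^ n) \<le> C * (r * v\<^sup>2 + excess \<gamma> r)"
  defines "\<delta> \<equiv> 1 - k" and "L \<equiv> ln (1 + T')" and "\<kappa> \<equiv> C * n / 2"
  shows "w0 \<omega> \<rho>\<^sub>0 u\<^sub>0 k \<le> 8 * (K / C) * \<delta> ^ 3 * L * ((\<kappa> * \<delta> / L)\<^sup>2 + (\<kappa> * \<delta> / L) ^ n)"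
proof -
  define A where "A = \<delta> * K / C * ((\<kappa> * \<delta> / L)\<^sup>2 + (\<kappa> * \<delta> / L) ^ n)"
  have L: "0 < L" and \<delta>: "0 < \<delta>" using T' k by (auto simp: L_def \<delta>_def)
  have A: "0 \<le> A" using C K L \<delta> by (simp add: A_def \<kappa>_def)
  let ?M = "lebesgue_on (slab T)"
  let ?N\<^sub>0 = "\<lambda>x. \<omega> \<bullet> (\<rho>\<^sub>0 x *\<^sub>R u\<^sub>0 x) + \<rho>\<^sub>0 x - 1"
  have Linf: "Linf_on UNIV \<rho>\<^sub>0" "Linf_on UNIV u\<^sub>0" and pos: "AE z in ?M. 0 < \<rho> z"
    using sol by (auto simp: weak_solution_def)
  have bound: "(LINT x|lebesgue. ?N\<^sub>0 x * wave n L \<omega> k \<epsilon> (0, x)) \<le> 8 * A * \<delta>\<^sup>2 * L" if \<epsilon>: "0 < \<epsilon>" for \<epsilon>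
  proof -
    interpret probe T T' "1 + T' + \<epsilon>" "wave n L \<omega> k \<epsilon>" "wave_t n L \<omega> k \<epsilon>" "wave_x n L \<omega> k \<epsilon>"
      unfolding L_def by (rule wave_probe[OF n T' \<epsilon>])
    define J where "J = (\<lambda>z. (\<omega> \<bullet> (\<rho> z *\<^sub>R u z) + \<rho> z - 1) * wave_t n L \<omega> k \<epsilon> z
      + \<rho> z * (1 + \<omega> \<bullet> u z) * (u z \<bullet> wave_x n L \<omega> k \<epsilon> z) + (pressure \<gamma> (\<rho> z) - 1 / \<gamma>) * (\<omega> \<bullet> wave_x n L \<omega> k \<epsilon> z))"
    note bal = momentum_flux_balance[OF sol, of \<omega>, folded J_def]
    have eq: "(LINT x|lebesgue. ?N\<^sub>0 x * wave n L \<omega> k \<epsilon> (0, x)) = (LINT z|?M. - J z)"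
      using bal \<gamma> by simp
    have "AE z in ?M. z \<in> slab T" using slab_lebesgue by (intro AE_I2) simp
    moreover have "AE z in ?M. z \<in> slab T \<longrightarrow> k + fst z \<le> \<omega> \<bullet> snd z \<longrightarrow> 1 + fst z < norm (snd z)
        \<longrightarrow> \<rho> z = 1 \<and> u z = 0"
      using quiet slab_lebesgue by (subst AE_restrict_space_iff) auto
    ultimately have "AE z in ?M. - J z \<le> A * cone_weight T' \<omega> k z"
      using pos
    proof eventually_elim
      case (elim z)
      obtain t x where z: "z = (t, x)" by (cases z)
      have t: "0 \<le> t" using elim by (simp add: slab_def z)
      have ci: "0 \<le> A * cone_weight T' \<omega> k z" using A by (simp add: cone_weight_def)
      \<comment> \<open>Behind the wave, and after \<open>T'\<close>, the test function vanishes; ahead of it and outside the ball the fluid is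
      at rest; the last case is the region of influence, where the cutoff equals \<open>1\<close>.\<close>
      consider "\<omega> \<bullet> x - t - k \<le> 0" | "0 < \<omega> \<bullet> x - t - k" "1 + t < norm x"
        | "0 < \<omega> \<bullet> x - t - k" "norm x \<le> 1 + t" "T' < t"
        | "0 < \<omega> \<bullet> x - t - k" "norm x \<le> 1 + t" "t \<le> T'" by linarith
      then show ?case
      proof cases
        case 1
        then have "J z = 0" by (simp add: J_def wave_t_def wave_x_def z max_def)
        then show ?thesis using ci by simp
      next
        case 2
        then have "\<rho> z = 1 \<and> u z = 0" using elim by (simp add: z)
        then have "J z = 0" by (simp add: J_def pressure_def)
        then show ?thesis using ci by simp
      next
        case 3
        then have "J z = 0" using supp[of z] t by (simp add: J_def z)
        then show ?thesis using ci by simp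
      next
        case 4
        define s where "s = \<omega> \<bullet> x - t - k"
        have s: "0 < s" "max s 0 = s" using 4 by (auto simp: s_def)
        have "\<bar>\<omega> \<bullet> x\<bar> \<le> norm x" using Cauchy_Schwarz_ineq2[of \<omega> x] \<omega> by simp
        then have s\<delta>: "s \<le> \<delta>" using 4 by (simp add: s_def \<delta>_def)
        define q where "q = (x \<bullet> x - (1 + t)\<^sup>2) / \<epsilon>"
        have "(norm x)\<^sup>2 \<le> (1 + t)\<^sup>2" using 4 by (intro power_mono) auto
        then have "q \<le> 0" using \<epsilon> by (simp add: q_def power2_norm_eq_inner divide_nonpos_pos)
        then have b: "bump q = 1" "bump' q = 0" by (auto simp: bump_cases)
        define r v where "r = \<rho> z" and "v = \<omega> \<bullet> u z"
        have r: "0 < r" using elim by (simp add: r_def)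
        have wt: "wave_t n L \<omega> k \<epsilon> z = clock' n L t * (s\<^sup>2 / 2) - clock n L t * s"
          and wx: "wave_x n L \<omega> k \<epsilon> z = (clock n L t * s) *\<^sub>R \<omega>"
          using s b by (simp_all add: wave_t_def wave_x_def z Let_def flip: s_def q_def)
        have \<omega>\<omega>: "\<omega> \<bullet> \<omega> = 1" using \<omega> by (simp add: norm_eq_1)
        \<comment> \<open>The linear fluxes cancel because the wave \<open>\<omega> \<bullet> x - t - k\<close> is constant along sound rays.\<close>
        have "J z = clock' n L t * (s\<^sup>2 / 2) * (r * v + r - 1) + clock n L t * s * (r * v\<^sup>2 + excess \<gamma> r)"
          unfolding J_def wt wx excess_def
          by (simp add: \<omega>\<omega> inner_commute flip: r_def v_def) (simp add: algebra_simps power2_eq_square)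
        moreover have "- (A / (1 + t)\<^sup>2) \<le> clock' n L t * (s\<^sup>2 / 2) * (r * v + r - 1)
            + clock n L t * s * (r * v\<^sup>2 + excess \<gamma> r)"
          unfolding A_def \<kappa>_def
          using dom[OF _ r, of _ v] r excess_nonneg[OF \<gamma> r] s s\<delta> \<delta> t
          by (intro clock_lower_bound C K n L) auto
        moreover have "cone_weight T' \<omega> k z = 1 / (1 + t)\<^sup>2"
          using 4 t by (simp add: cone_weight_def z Omega_def Omega_inf_def)
        ultimately show ?thesis by simp
      qed
    qed
    then have "(\<integral>\<^sup>+ z. ennreal (- J z) \<partial>?M) \<le> (\<integral>\<^sup>+ z. ennreal (A * cone_weight T' \<omega> k z) \<partial>?M)"
      by (intro nn_integral_mono_AE) (auto elim!: eventually_mono intro: ennreal_leI)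
    also have "\<dots> = (\<integral>\<^sup>+ z. ennreal (A * cone_weight T' \<omega> k z) * indicator (slab T) z \<partial>lebesgue)"
      using slab_lebesgue by (intro nn_integral_restrict_space) auto
    also have "\<dots> \<le> (\<integral>\<^sup>+ z. ennreal (A * cone_weight T' \<omega> k z) \<partial>lebesgue)"
      by (intro nn_integral_mono) (auto simp: indicator_def)
    also have "\<dots> = (\<integral>\<^sup>+ z. ennreal (A * cone_weight T' \<omega> k z) \<partial>lborel)"
      by (rule nn_integral_completion)
    also have "\<dots> = ennreal A * (\<integral>\<^sup>+ z. ennreal (cone_weight T' \<omega> k z) \<partial>lborel)"
      using A measurable_compose[OF cone_weight_measurable measurable_ennreal, of T' \<omega> k]
      by (simp add: ennreal_mult' nn_integral_cmult)
    also have "\<dots> \<le> ennreal A * ennreal (8 * (1 - k)\<^sup>2 * ln (1 + T'))"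
      by (intro mult_left_mono nn_integral_cone_le \<omega> k T') auto
    also have "\<dots> = ennreal (8 * A * \<delta>\<^sup>2 * L)"
      using A L by (simp add: \<delta>_def L_def mult_ac flip: ennreal_mult')
    finally have "(LINT z|?M. - J z) \<le> 8 * A * \<delta>\<^sup>2 * L"
      using A L by (intro integral_real_bounded) auto
    then show ?thesis using eq by simp
  qed
  have N0: "Linf_on UNIV ?N\<^sub>0"
  proof -
    obtain a where a: "AE x in lebesgue_on UNIV. norm (\<omega> \<bullet> (\<rho>\<^sub>0 x *\<^sub>R u\<^sub>0 x)) \<le> a"
      using Linf_on_inner[OF Linf_on_scaleR[OF Linf]] unfolding Linf_on_def by blast
    obtain b where b: "AE x in lebesgue_on UNIV. norm (\<rho>\<^sub>0 x) \<le> b"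
      using Linf unfolding Linf_on_def by blast
    have "AE x in lebesgue_on UNIV. norm (?N\<^sub>0 x) \<le> a + b + 1"
      using a b by eventually_elim auto
    moreover have "?N\<^sub>0 \<in> borel_measurable (lebesgue_on UNIV)"
      using Linf unfolding Linf_on_def by auto
    ultimately show ?thesis unfolding Linf_on_def by blast
  qed
  have "w0 \<omega> \<rho>\<^sub>0 u\<^sub>0 k \<le> 8 * A * \<delta>\<^sup>2 * L"
    unfolding w0_def
  proof (rule LIMSEQ_le_const2[OF wave_initial_limit[OF N0 \<omega> k(1)]], intro exI allI impI)
    show "(LINT x|lebesgue. ?N\<^sub>0 x * wave n L \<omega> k (1 / real (Suc j)) (0, x)) \<le> 8 * A * \<delta>\<^sup>2 * L" for j
      by (rule bound) simp
  qed
  also have "\<dots> = 8 * (K / C) * \<delta> ^ 3 * L * ((\<kappa> * \<delta> / L)\<^sup>2 + (\<kappa> * \<delta> / L) ^ n)"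
    by (simp add: A_def power2_eq_square power3_eq_cube)
  finally show ?thesis .
qed

section \<open>The lifespan\<close>

text \<open>The bound is compared with the quantity \<open>(1 - k)\<^sup>5 / w\<close> that the moment estimate produces:
  \<open>(k - k\<^sub>0) (1 - k)\<^sup>5 \<le> (1 - k\<^sub>0)\<^sup>6\<close>, and the additional factor for \<open>\<gamma> < 2\<close> is at least \<open>1\<close>.\<close>

lemma exp_le_lifespan_fun:
  assumes "0 < \<Gamma>" "k\<^sub>0 < k" "k < 1" "0 < w k"
  shows "exp (\<Gamma> * (1 - k) ^ 5 / w k) \<le> lifespan_fun \<gamma> \<Gamma> w k k\<^sub>0"
proof -
  define Y where "Y = \<Gamma> * ((1 - k\<^sub>0) ^ 6 / ((k - k\<^sub>0) * w k))"
  have Y0: "0 \<le> Y" using assms by (simp add: Y_def)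
  have "(k - k\<^sub>0) * (1 - k) ^ 5 \<le> (1 - k\<^sub>0) * (1 - k\<^sub>0) ^ 5"
    using assms by (intro mult_mono power_mono) auto
  then have "(1 - k) ^ 5 \<le> (1 - k\<^sub>0) ^ 6 / (k - k\<^sub>0)"
    using assms by (simp add: field_simps eval_nat_numeral)
  then have "(1 - k) ^ 5 / w k \<le> (1 - k\<^sub>0) ^ 6 / (k - k\<^sub>0) / w k"
    using assms by (intro divide_right_mono) auto
  then have "\<Gamma> * ((1 - k) ^ 5 / w k) \<le> Y"
    unfolding Y_def using assms by (intro mult_left_mono) auto
  then have Y: "\<Gamma> * (1 - k) ^ 5 / w k \<le> Y" by simp
  show ?thesis
  proof (cases "2 \<le> \<gamma>")
    case True
    then show ?thesis using Y by (simp add: lifespan_fun_def Y_def)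
  next
    case False
    have "1 \<le> (1 + 3 * w k / (1 - k) ^ 4) powr (2 - \<gamma>)"
      using False assms by (intro ge_one_powr_ge_zero) auto
    then have "Y * 1 \<le> Y * (1 + 3 * w k / (1 - k) ^ 4) powr (2 - \<gamma>)"
      using Y0 by (intro mult_left_mono) auto
    then show ?thesis
      unfolding lifespan_fun_def Y_def[symmetric] using False Y by simp
  qed
qed

text \<open>Unless \<open>L\<close> is small compared with \<open>\<delta>\<close>, the power \<open>n\<close> is controlled by the square, and the moment
  bound says that \<open>w\<close> is at most of order \<open>\<delta>\<^sup>5 / L\<close>.\<close>

lemma logarithmic_alternative:
  fixes c :: real
  assumes w: "0 < w" "w \<le> c * \<delta> ^ 3 * L * ((\<kappa> * \<delta> / L)\<^sup>2 + (\<kappa> * \<delta> / L) ^ n)"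
    and pos: "0 \<le> c" "0 < \<kappa>" "0 < \<delta>" "0 < L" and n: "2 \<le> n"
  shows "L < \<delta> / 4 \<or> L \<le> c * \<kappa>\<^sup>2 * (1 + (4 * \<kappa>) ^ (n - 2)) * \<delta> ^ 5 / w"
proof (cases "L < \<delta> / 4")
  case False
  then have "\<kappa> * \<delta> / L \<le> 4 * \<kappa>" using pos by (simp add: field_simps)
  then have "(\<kappa> * \<delta> / L) ^ (n - 2) \<le> (4 * \<kappa>) ^ (n - 2)" using pos by (intro power_mono) auto
  then have "(\<kappa> * \<delta> / L)\<^sup>2 * (1 + (\<kappa> * \<delta> / L) ^ (n - 2)) \<le> (\<kappa> * \<delta> / L)\<^sup>2 * (1 + (4 * \<kappa>) ^ (n - 2))"
    by (intro mult_left_mono) auto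
  moreover have "(\<kappa> * \<delta> / L) ^ n = (\<kappa> * \<delta> / L)\<^sup>2 * (\<kappa> * \<delta> / L) ^ (n - 2)"
    using power_add[of "\<kappa> * \<delta> / L" 2 "n - 2"] unfolding le_add_diff_inverse[OF n] .
  ultimately have "(\<kappa> * \<delta> / L)\<^sup>2 + (\<kappa> * \<delta> / L) ^ n \<le> (\<kappa> * \<delta> / L)\<^sup>2 * (1 + (4 * \<kappa>) ^ (n - 2))"
    by (simp add: distrib_left)
  then have "w \<le> c * \<delta> ^ 3 * L * ((\<kappa> * \<delta> / L)\<^sup>2 * (1 + (4 * \<kappa>) ^ (n - 2)))"
    using pos by (intro order_trans[OF w(2)] mult_left_mono) auto
  also have "\<dots> = c * \<kappa>\<^sup>2 * (1 + (4 * \<kappa>) ^ (n - 2)) * \<delta> ^ 5 / L"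
    using pos by (simp add: power2_eq_square eval_nat_numeral)
  finally have "w \<le> c * \<kappa>\<^sup>2 * (1 + (4 * \<kappa>) ^ (n - 2)) * \<delta> ^ 5 / L" .
  then show ?thesis
    using w(1) pos by (simp add: pos_le_divide_eq mult.commute)
qed simp

theorem theorem1:
  fixes \<gamma> :: real
  assumes "\<gamma> > 1"
  shows "\<exists>\<Gamma>>0. \<forall>(T::real) (\<rho>::spacetime \<Rightarrow> real) (u::spacetime \<Rightarrow> space)
           (\<rho>\<^sub>0::space \<Rightarrow> real) (u\<^sub>0::space \<Rightarrow> space) (\<omega>::space) (k\<^sub>0::real).
         0 < T \<longrightarrow>
         weak_solution \<gamma> T \<rho> u \<rho>\<^sub>0 u\<^sub>0 \<longrightarrow>
         norm \<omega> = 1 \<longrightarrow>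
         0 \<le> k\<^sub>0 \<longrightarrow> k\<^sub>0 < 1 \<longrightarrow>
         ess_supp (slab T) (\<lambda>z. (\<rho> z - 1, u z)) \<inter> spacetime_region T (Omega_inf \<omega> k\<^sub>0)
           \<subseteq> spacetime_region T (Omega \<omega> k\<^sub>0 1) \<longrightarrow>
         (\<forall>k\<in>{k\<^sub>0..<1}. 0 < w0 \<omega> \<rho>\<^sub>0 u\<^sub>0 k) \<longrightarrow>
         antimono_on {k\<^sub>0..<1} (w0 \<omega> \<rho>\<^sub>0 u\<^sub>0) \<longrightarrow>
         T \<le> lifespan_bound \<gamma> \<Gamma> (w0 \<omega> \<rho>\<^sub>0 u\<^sub>0) k\<^sub>0"
proof -
  obtain C K and n :: nat where C: "1 \<le> C" and K: "1 \<le> K" and n: "3 \<le> n"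
    and dom: "\<And>l r v. 0 \<le> l \<Longrightarrow> 0 < r \<Longrightarrow>
          l * (r * v + r - 1) - K * (l\<^sup>2 + l ^ n) \<le> C * (r * v\<^sup>2 + excess \<gamma> r)"
    using flux_dominates_momentum[OF assms] by metis
  define \<kappa> where "\<kappa> = C * n / 2"
  have \<kappa>: "0 < \<kappa>" using C n by (simp add: \<kappa>_def)
  define \<Gamma> where "\<Gamma> = 8 * (K / C) * \<kappa>\<^sup>2 * (1 + (4 * \<kappa>) ^ (n - 2))"
  have \<Gamma>: "0 < \<Gamma>" unfolding \<Gamma>_def using C K \<kappa> by (intro mult_pos_pos divide_pos_pos add_pos_nonneg) auto
  show ?thesis
  proof (intro exI[of _ \<Gamma>] conjI \<Gamma> allI impI)
    fix T :: real and \<rho> u \<rho>\<^sub>0 u\<^sub>0 \<omega> and k\<^sub>0 :: real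
    assume T: "0 < T" and sol: "weak_solution \<gamma> T \<rho> u \<rho>\<^sub>0 u\<^sub>0" and \<omega>: "norm \<omega> = 1"
      and k\<^sub>0: "0 \<le> k\<^sub>0" "k\<^sub>0 < 1"
      and supp: "ess_supp (slab T) (\<lambda>z. (\<rho> z - 1, u z)) \<inter> spacetime_region T (Omega_inf \<omega> k\<^sub>0)
           \<subseteq> spacetime_region T (Omega \<omega> k\<^sub>0 1)"
      and pos: "\<forall>k\<in>{k\<^sub>0..<1}. 0 < w0 \<omega> \<rho>\<^sub>0 u\<^sub>0 k"
    have "T + (1 + k\<^sub>0) / 2 \<le> lifespan_fun \<gamma> \<Gamma> (w0 \<omega> \<rho>\<^sub>0 u\<^sub>0) k k\<^sub>0" if "k \<in> {k\<^sub>0<..<1}" for k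
    proof -
      have k: "k\<^sub>0 < k" "k < 1" "0 \<le> k" using that k\<^sub>0 by auto
      define w where "w = w0 \<omega> \<rho>\<^sub>0 u\<^sub>0 k"
      have w: "0 < w" using pos k by (simp add: w_def)
      define X where "X = \<Gamma> * (1 - k) ^ 5 / w"
      have X: "0 < X" using \<Gamma> w k by (simp add: X_def)
      have "T' \<le> exp X - (1 + k\<^sub>0) / 2" if T': "0 < T'" "T' < T" for T'
      proof -
        define L where "L = ln (1 + T')"
        have L: "0 < L" "exp L = 1 + T'" using T' by (auto simp: L_def)
        have "w \<le> 8 * (K / C) * (1 - k) ^ 3 * L * ((\<kappa> * (1 - k) / L)\<^sup>2 + (\<kappa> * (1 - k) / L) ^ n)"
          unfolding w_def L_def \<kappa>_def
          using C K n by (intro moment_bound[OF assms sol \<omega> k(3,2) T' quiet_outside_support[OF supp] _ _ _ dom] less_imp_le[OF k(1)]) auto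
        from logarithmic_alternative[OF w this] C K n k \<kappa> L
        consider "L < (1 - k) / 4" | "L \<le> X"
          by (fastforce simp: X_def \<Gamma>_def)
        \<comment> \<open>In the first case \<open>T'\<close> is at most \<open>(1 - k) / 2\<close>, which the term \<open>(1 + k\<^sub>0) / 2\<close> leaves room for.\<close>
        then show ?thesis
        proof cases
          case 1
          then have "L\<^sup>2 \<le> L" using L k by (simp add: power2_eq_square)
          moreover have "exp L \<le> 1 + L + L\<^sup>2" using 1 L k by (intro exp_bound) auto
          moreover have "2 * L < (1 - k\<^sub>0) / 2" using 1 k by (simp add: field_simps)
          ultimately show ?thesis using one_le_exp_iff[of X] X unfolding L(2) by argo
        next
          case 2
          then have "1 + T' \<le> exp X" using L by (metis exp_le_cancel_iff)
          then show ?thesis using k\<^sub>0 by argo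
        qed
      qed
      then have "T \<le> exp X - (1 + k\<^sub>0) / 2"
        using T by (intro dense_le_bounded[of 0 T])
      moreover have "exp X \<le> lifespan_fun \<gamma> \<Gamma> (w0 \<omega> \<rho>\<^sub>0 u\<^sub>0) k k\<^sub>0"
        unfolding X_def w_def using w k \<Gamma> by (intro exp_le_lifespan_fun) (auto simp: w_def)
      ultimately show ?thesis by linarith
    qed
    then have "T + (1 + k\<^sub>0) / 2 \<le> (INF k\<in>{k\<^sub>0<..<1}. lifespan_fun \<gamma> \<Gamma> (w0 \<omega> \<rho>\<^sub>0 u\<^sub>0) k k\<^sub>0)"
      using k\<^sub>0 by (intro cINF_greatest) auto
    then show "T \<le> lifespan_bound \<gamma> \<Gamma> (w0 \<omega> \<rho>\<^sub>0 u\<^sub>0) k\<^sub>0"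
      by (simp add: lifespan_bound_def)
  qed
qed

end
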